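(* Let $n\ge 2$ and set $k=\lfloor n/2\rfloor$. For $Y=(y_{i,j})\in\mathbb R^{C}$, $i\in[k]$ and $j\in[n-1]$ write $$L_{i,j}(Y)=\sum_{i'=1}^{\min\{i-1,j\}}y_{i',i}+\sum_{j'=i}^{\min\{n+1-i,j\}}y_{i,j'}+\sum_{i'=n-i+2}^{j}y_{n+1-i',\,n+1-i},$$ and, if $n$ is odd, write $M_j(Y)=\sum_{i'=1}^{j}y_{i',k+1}$ for $j\in[k]$. The facets of $P^{\mathrm{core}}_{\mathrm{DASASM}}$ are exactly the following faces of $P^{\mathrm{core}}_{\mathrm{DASASM}}$, one for each listed equation: (a) $\{L_{i,j}(Y)=0\}$ for $(i,j)\in\{(1,1)\}\cup([2,k]\times[n-2])$; (b) $\{L_{i,j}(Y)=1\}$ for $(i,j)\in\{(1,n-1)\}\cup([2,k]\times[2,n-1])$; and, only if $n$ is odd, additionally: (c) $\{M_j(Y)=0\}$ for $j\in[k]$ and $\{M_j(Y)=1\}$ for $j\in[2,k]$. In particular, the number of facets of $P^{\mathrm{core}}_{\mathrm{DASASM}}$ is $(n-2)^2+2$.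
   Context: $[a,b]=\{a,a+1,\dots,b\}$ for integers $a\le b$, $[a,b]=\emptyset$ if $a>b$, and $[n]=[1,n]$; empty sums are $0$. An $n\times n$ alternating sign matrix (ASM) is an $n\times n$ matrix with entries in $\{0,1,-1\}$ such that in each row and each column the non-zero entries alternate in sign and the first and last non-zero entries are $1$ (so every row and column sums to $1$). A DASASM is an $n\times n$ ASM $X$ with $x_{i,j}=x_{j,i}=x_{n+1-j,n+1-i}$ for all $i,j\in[n]$. With $k=\lfloor n/2\rfloor$, the set of core positions is $C=\{(i,j)\in[k]\times[n]: i\le j\le n+1-i\}$. The core of a DASASM $X$ is $(x_{i,j})_{(i,j)\in C}\in\mathbb R^C$, and $P^{\mathrm{core}}_{\mathrm{DASASM}}\subseteq\mathbb R^{C}$ is the convex hull of the cores of all $n\times n$ DASASMs. A facet of a polytope $P$ is a face of dimension $\dim P-1$; by "the face $\{L(Y)=c\}$" we mean $\{Y\in P^{\mathrm{core}}_{\mathrm{DASASM}}: L(Y)=c\}$. *)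

theory Defs
  imports "HOL-Analysis.Analysis"
begin

text \<open>
  An \<open>n \<times> n\<close> matrix is a function \<open>nat \<Rightarrow> nat \<Rightarrow> real\<close> of which only the entries with
  both indices in \<open>{1..n}\<close> matter.
\<close>

definition alternating :: "real list \<Rightarrow> bool" where
  "alternating xs \<longleftrightarrow>
     (let ys = filter (\<lambda>x. x \<noteq> 0) xs in
       ys \<noteq> [] \<and> hd ys = 1 \<and> last ys = 1 \<and> successively (\<lambda>a b. sgn b = - sgn a) ys)"

definition ASM :: "nat \<Rightarrow> (nat \<Rightarrow> nat \<Rightarrow> real) \<Rightarrow> bool" where
  "ASM n X \<longleftrightarrow>
     (\<forall>i\<in>{1..n}. \<forall>j\<in>{1..n}. X i j \<in> {0, 1, -1}) \<and>
     (\<forall>i\<in>{1..n}. alternating (map (\<lambda>j. X i j) [1..<n+1])) \<and>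
     (\<forall>j\<in>{1..n}. alternating (map (\<lambda>i. X i j) [1..<n+1]))"

definition DASASM :: "nat \<Rightarrow> (nat \<Rightarrow> nat \<Rightarrow> real) \<Rightarrow> bool" where
  "DASASM n X \<longleftrightarrow>
     ASM n X \<and>
     (\<forall>i\<in>{1..n}. \<forall>j\<in>{1..n}. X i j = X j i \<and> X i j = X (n + 1 - j) (n + 1 - i))"

definition core_positions :: "nat \<Rightarrow> (nat \<times> nat) set" where
  "core_positions n = {(i, j). i \<in> {1..n div 2} \<and> j \<in> {1..n} \<and> i \<le> j \<and> j \<le> n + 1 - i}"

text \<open>
  The space \<open>\<real>\<^sup>C\<close>, for \<open>C = core_positions n\<close>, is rendered as \<open>real ^ 'c\<close>, where the finite
  type \<open>'c\<close> is identified with \<open>C\<close> by a bijection \<open>pos :: 'c \<Rightarrow> nat \<times> nat\<close>. The coordinate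
  \<open>y\<^bsub>i,j\<^esub>\<close> of \<open>Y\<close> is \<open>entry pos Y i j\<close>; it is meaningful only for \<open>(i, j) \<in> C\<close>.
\<close>

definition entry :: "('c::finite \<Rightarrow> nat \<times> nat) \<Rightarrow> real ^ 'c \<Rightarrow> nat \<Rightarrow> nat \<Rightarrow> real" where
  "entry pos Y i j = Y $ inv pos (i, j)"

definition core :: "('c::finite \<Rightarrow> nat \<times> nat) \<Rightarrow> (nat \<Rightarrow> nat \<Rightarrow> real) \<Rightarrow> real ^ 'c" where
  "core pos X = (\<chi> c. case pos c of (i, j) \<Rightarrow> X i j)"

definition P_core :: "nat \<Rightarrow> ('c::finite \<Rightarrow> nat \<times> nat) \<Rightarrow> (real ^ 'c) set" where
  "P_core n pos = convex hull {core pos X | X. DASASM n X}"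

text \<open>
  For \<open>1 \<le> i \<le> n div 2\<close> and \<open>j \<le> n - 1\<close>, no subtraction below is truncated and all
  entries have their position in \<open>core_positions n\<close>.
\<close>

definition L_sum :: "nat \<Rightarrow> ('c::finite \<Rightarrow> nat \<times> nat) \<Rightarrow> nat \<Rightarrow> nat \<Rightarrow> real ^ 'c \<Rightarrow> real" where
  "L_sum n pos i j Y =
     (\<Sum>i' = 1..min (i - 1) j. entry pos Y i' i) +
     (\<Sum>j' = i..min (n + 1 - i) j. entry pos Y i j') +
     (\<Sum>i' = n - i + 2..j. entry pos Y (n + 1 - i') (n + 1 - i))"

definition M_sum :: "nat \<Rightarrow> ('c::finite \<Rightarrow> nat \<times> nat) \<Rightarrow> nat \<Rightarrow> real ^ 'c \<Rightarrow> real" where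
  "M_sum n pos j Y = (\<Sum>i' = 1..j. entry pos Y i' (n div 2 + 1))"

text \<open>
  Formal equations \<open>L\<^bsub>i,j\<^esub>(Y) = c\<close> and \<open>M\<^bsub>j\<^esub>(Y) = c\<close>, kept apart from the faces they
  define so that it can be said that different equations give different faces.
\<close>

datatype equation = L_eq nat nat real | M_eq nat real

fun eq_face :: "nat \<Rightarrow> ('c::finite \<Rightarrow> nat \<times> nat) \<Rightarrow> equation \<Rightarrow> (real ^ 'c) set" where
  "eq_face n pos (L_eq i j c) = {Y \<in> P_core n pos. L_sum n pos i j Y = c}"
| "eq_face n pos (M_eq j c) = {Y \<in> P_core n pos. M_sum n pos j Y = c}"

definition facet_equations :: "nat \<Rightarrow> equation set" where
  "facet_equations n =
     (let k = n div 2 in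
       {L_eq i j 0 | i j. (i, j) \<in> {(1, 1)} \<union> {2..k} \<times> {1..n - 2}} \<union>
       {L_eq i j 1 | i j. (i, j) \<in> {(1, n - 1)} \<union> {2..k} \<times> {2..n - 1}} \<union>
       (if odd n then {M_eq j 0 | j. j \<in> {1..k}} \<union> {M_eq j 1 | j. j \<in> {2..k}} else {}))"

end

theory Submission
  imports Defs
begin

text \<open>
  Pass from a DASASM to its corner sums, the sums of the entries in the upper left rectangles.
  The symmetries make the corner sums at the points \<open>(i, j)\<close> with \<open>i \<le> j\<close> and \<open>i + j \<le> n\<close>
  free coordinates. In these coordinates every \<open>L\<^bsub>i,j\<^esub>\<close> and \<open>M\<^bsub>j\<^esub>\<close>, up to replacing \<open>L\<close> by
  \<open>1 - L\<close>, is the difference of the corner sums at two adjacent points, so the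
  polytope is described by bounding differences between 0 and 1. Such a system has integral
  vertices: all corner sums congruent modulo 1 to a given non-integer can be shifted together
  in both directions. For the first row some of the bounds follow from the others, and for each of
  the remaining bounds there is an explicit point at which it is the only tight one.
\<close>

section \<open>Prefix sums of alternating lists and bisymmetric matrices\<close>

text \<open>A partial sum of a row is a vertical step of the corner sums. Outside the triangle of
  free coordinates a reflection turns this step into a horizontal one inside it, and beyond the
  antidiagonal also complements it; this is where \<open>1 - L\<close> comes from. For odd
  \<open>n\<close> the rows up to \<open>n div 2\<close> yield no horizontal steps into the middle
  column, and the sums \<open>M\<close> supply them. Corner sums vanish on row 0. This pins the
  class of the integers, so that a shift of any other class respects the boundary. It also turns the
  vertical bounds of row 1 into bounds on values, which monotonicity along the row links to one
  another. The polytope is not full-dimensional, since the row totals are fixed, so facets are taken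
  relative to the affine space \<open>core_hull\<close>. What is required there is one strict point
  and, for each listed bound, a point of that space at which it alone is tight. Such points need be
  neither integral nor cores of matrices with entries 0, 1, -1: any function on the triangle that
  vanishes on row 0 extends to corner sums with the right row totals, so witnesses can be given by
  simple formulas.\<close>

lemma all_le_Suc_split: "(\<forall>m\<le>Suc l. P m) \<longleftrightarrow> P 0 \<and> (\<forall>m\<le>l. P (Suc m))"
proof
  assume r: "P 0 \<and> (\<forall>m\<le>l. P (Suc m))"
  show "\<forall>m\<le>Suc l. P m"
  proof (intro allI impI)
    fix m assume "m \<le> Suc l"
    then show "P m" using r by (cases m) auto
  qed
qed auto

lemma alternating_iff_prefix_sums:
  assumes "set xs \<subseteq> {0, 1, -1}"
  shows "alternating xs \<longleftrightarrow>
    (\<forall>m\<le>length xs. sum_list (take m xs) \<in> {0..1}) \<and> sum_list xs = 1"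
proof -
  let ?ys = "\<lambda>xs. filter (\<lambda>x::real. x \<noteq> 0) xs"
  let ?alt = "successively (\<lambda>a b. sgn b = - sgn (a::real))"
  \<comment> \<open>After an entry 1 the remaining list is read from the running sum 1, and after a
    following -1 again from 0. The induction therefore treats both starting values at once; only
    from 1 may all remaining entries vanish.\<close>
  have "((\<forall>m\<le>length xs. sum_list (take m xs) \<in> {0..1}) \<and> sum_list xs = 1 \<longleftrightarrow>
          ?ys xs \<noteq> [] \<and> hd (?ys xs) = 1 \<and> last (?ys xs) = 1 \<and> ?alt (?ys xs)) \<and>
        ((\<forall>m\<le>length xs. 1 + sum_list (take m xs) \<in> {0..1}) \<and> sum_list xs = 0 \<longleftrightarrow>
          ?ys xs = [] \<or> (hd (?ys xs) = -1 \<and> last (?ys xs) = 1 \<and> ?alt (?ys xs)))"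
    (is "(?A xs \<longleftrightarrow> ?A' xs) \<and> (?B xs \<longleftrightarrow> ?B' xs)")
    using assms
  proof (induction xs)
    case Nil
    then show ?case by simp
  next
    case (Cons x xs)
    then have IH: "?A xs \<longleftrightarrow> ?A' xs" "?B xs \<longleftrightarrow> ?B' xs" and x: "x = 0 \<or> x = 1 \<or> x = -1"
      by auto
    have rec: "?A (x # xs) \<longleftrightarrow> (\<forall>m\<le>length xs. x + sum_list (take m xs) \<in> {0..1}) \<and> x + sum_list xs = 1"
      "?B (x # xs) \<longleftrightarrow> (\<forall>m\<le>length xs. 1 + (x + sum_list (take m xs)) \<in> {0..1}) \<and> x + sum_list xs = 0"
      by (auto simp: all_le_Suc_split)
    have ys: "\<forall>a\<in>set (?ys xs). a = 1 \<or> a = -1" using Cons.prems by auto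
    consider "x = 0" | "x = 1" | "x = -1" using x by blast
    then show ?case
    proof cases
      case 1
      then show ?thesis using IH rec by simp
    next
      case 2
      have "?B' xs \<longleftrightarrow> ?A' (x # xs)"
        using 2 ys by (cases "?ys xs") auto
      moreover have "?A (x # xs) \<longleftrightarrow> ?B xs" using 2 rec(1) by simp
      ultimately have "?A (x # xs) \<longleftrightarrow> ?A' (x # xs)" using IH(2) by (simp only:)
      moreover have "\<not> ?B (x # xs)" using 2 rec(2) by (auto dest: spec[of _ 0])
      moreover have "\<not> ?B' (x # xs)" using 2 by simp
      ultimately show ?thesis by (simp only:)
    next
      case 3
      have "?A' xs \<longleftrightarrow> ?B' (x # xs)"
        using 3 ys by (cases "?ys xs") auto
      moreover have "?B (x # xs) \<longleftrightarrow> ?A xs" using 3 rec(2) by simp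
      ultimately have "?B (x # xs) \<longleftrightarrow> ?B' (x # xs)" using IH(1) by (simp only:)
      moreover have "\<not> ?A (x # xs)" using 3 rec(1) by (auto dest: spec[of _ 0])
      moreover have "\<not> ?A' (x # xs)" using 3 by simp
      ultimately show ?thesis by (simp only:)
    qed
  qed
  then show ?thesis by (simp add: alternating_def Let_def)
qed

definition row_sum :: "(nat \<Rightarrow> nat \<Rightarrow> real) \<Rightarrow> nat \<Rightarrow> nat \<Rightarrow> real" where
  "row_sum X i j = (\<Sum>b = 1..j. X i b)"

lemma row_sum_0 [simp]: "row_sum X i 0 = 0"
  by (simp add: row_sum_def)

lemma row_sum_Suc: "row_sum X i (Suc j) = row_sum X i j + X i (Suc j)"
  by (simp add: row_sum_def)

lemma row_sum_diff: "1 \<le> j \<Longrightarrow> row_sum X i j - row_sum X i (j - 1) = X i j"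
  by (cases j) (simp_all add: row_sum_Suc)

definition bisymmetric :: "nat \<Rightarrow> (nat \<Rightarrow> nat \<Rightarrow> real) \<Rightarrow> bool" where
  "bisymmetric n X \<longleftrightarrow>
    (\<forall>i\<in>{1..n}. \<forall>j\<in>{1..n}. X i j = X j i \<and> X i j = X (n + 1 - j) (n + 1 - i))"

lemma bisymmetricD:
  assumes "bisymmetric n X" "1 \<le> i" "i \<le> n" "1 \<le> j" "j \<le> n"
  shows "X i j = X j i" "X i j = X (n + 1 - j) (n + 1 - i)" "X i j = X (n + 1 - i) (n + 1 - j)"
proof -
  have *: "X a b = X b a \<and> X a b = X (n + 1 - b) (n + 1 - a)"
    if "a \<in> {1..n}" "b \<in> {1..n}" for a b
    using assms(1) that unfolding bisymmetric_def by blast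
  have ij: "i \<in> {1..n}" "j \<in> {1..n}" using assms by auto
  show "X i j = X j i" "X i j = X (n + 1 - j) (n + 1 - i)" using *[OF ij] by blast+
  show "X i j = X (n + 1 - i) (n + 1 - j)"
    using *[OF ij] *[OF ij(2,1)] by metis
qed

lemma alternating_map_iff:
  assumes "\<And>j. 1 \<le> j \<Longrightarrow> j \<le> n \<Longrightarrow> f j \<in> {0, 1, -1::real}"
  shows "alternating (map f [1..<n+1]) \<longleftrightarrow>
    (\<forall>j\<le>n. (\<Sum>b = 1..j. f b) \<in> {0..1}) \<and> (\<Sum>b = 1..n. f b) = 1"
proof -
  have "sum_list (take j (map f [1..<n+1])) = (\<Sum>b = 1..j. f b)" if "j \<le> n" for j
  proof -
    have "take j (map f [1..<n+1]) = map f [1..<j+1]"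
      using that by (simp add: take_map del: upt_Suc)
    then show ?thesis
      by (simp only: interv_sum_list_conv_sum_set_nat set_upt atLeastLessThanSuc_atLeastAtMost Suc_eq_plus1[symmetric])
  qed
  moreover have "set (map f [1..<n+1]) \<subseteq> {0, 1, -1}"
    using assms by (force simp del: upt_Suc)
  ultimately show ?thesis
    by (subst alternating_iff_prefix_sums)
      (auto simp del: upt_Suc simp: interv_sum_list_conv_sum_set_nat atLeastLessThanSuc_atLeastAtMost)
qed

text \<open>Symmetry makes column \<open>j\<close> the same list as row \<open>j\<close>, so only
  prefix sums of rows remain.\<close>

lemma DASASM_iff:
  "DASASM n X \<longleftrightarrow> bisymmetric n X \<and>
     (\<forall>i\<in>{1..n}. \<forall>j\<in>{1..n}. X i j \<in> {0, 1, -1}) \<and>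
     (\<forall>i\<in>{1..n}. (\<forall>j\<le>n. row_sum X i j \<in> {0..1}) \<and> row_sum X i n = 1)"
proof (cases "bisymmetric n X \<and> (\<forall>i\<in>{1..n}. \<forall>j\<in>{1..n}. X i j \<in> {0, 1, -1})")
  case True
  have "map (\<lambda>i. X i j) [1..<n+1] = map (X j) [1..<n+1]" if "j \<in> {1..n}" for j
    using True that by (intro map_cong refl bisymmetricD(1)[of n]) (auto simp del: upt_Suc)
  then have "(\<forall>j\<in>{1..n}. alternating (map (\<lambda>i. X i j) [1..<n+1])) \<longleftrightarrow>
      (\<forall>j\<in>{1..n}. alternating (map (X j) [1..<n+1]))"
    by (intro ball_cong refl) (simp only:)
  then have "ASM n X \<longleftrightarrow> (\<forall>i\<in>{1..n}. alternating (map (X i) [1..<n+1]))"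
    using True unfolding ASM_def by blast
  also have "\<dots> \<longleftrightarrow> (\<forall>i\<in>{1..n}. (\<forall>j\<le>n. row_sum X i j \<in> {0..1}) \<and> row_sum X i n = 1)"
    unfolding row_sum_def using True by (intro ball_cong refl alternating_map_iff) auto
  finally have "ASM n X \<longleftrightarrow>
      (\<forall>i\<in>{1..n}. (\<forall>j\<le>n. row_sum X i j \<in> {0..1}) \<and> row_sum X i n = 1)" .
  then show ?thesis using True unfolding DASASM_def bisymmetric_def by blast
next
  case False
  then show ?thesis unfolding DASASM_def ASM_def bisymmetric_def by blast
qed

text \<open>The two reflections compose to a half turn, so row \<open>n + 1 - i\<close> is row
  \<open>i\<close> read backwards, and a prefix of one is a suffix of the other.\<close>

lemma row_sum_reflect:
  assumes X: "bisymmetric n X" and i: "1 \<le> i" "i \<le> n" and j: "j \<le> n"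
  shows "row_sum X (n + 1 - i) j = row_sum X i n - row_sum X i (n - j)"
proof -
  have "row_sum X (n + 1 - i) j = (\<Sum>b = 1..j. X i (n + 1 - b))"
    unfolding row_sum_def
  proof (rule sum.cong)
    fix b assume "b \<in> {1..j}"
    then have "X (n + 1 - i) b = X (n + 1 - (n + 1 - i)) (n + 1 - b)"
      by (intro bisymmetricD(3)[OF X]) (use i j in auto)
    moreover have "n + 1 - (n + 1 - i) = i" using i by simp
    ultimately show "X (n + 1 - i) b = X i (n + 1 - b)" by (simp only:)
  qed simp
  also have "\<dots> = (\<Sum>b = n - j + 1..n. X i b)"
    by (rule sum.reindex_bij_witness[of _ "\<lambda>b. n + 1 - b" "\<lambda>b. n + 1 - b"]) (use j in auto)
  also have "\<dots> = row_sum X i n - row_sum X i (n - j)"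
  proof -
    have "{1..n} = {1..n - j} \<union> {n - j + 1..n}" using j by auto
    then have "row_sum X i n = row_sum X i (n - j) + (\<Sum>b = n - j + 1..n. X i b)"
      unfolding row_sum_def by (simp add: sum.union_disjoint)
    then show ?thesis by simp
  qed
  finally show ?thesis .
qed

section \<open>Corner sums\<close>

text \<open>The mixed second difference, which recovers the entries of a matrix from its corner
  sums.\<close>

definition diff2 :: "(nat \<Rightarrow> nat \<Rightarrow> real) \<Rightarrow> nat \<Rightarrow> nat \<Rightarrow> real" where
  "diff2 E i j = E i j - E (i - 1) j - E i (j - 1) + E (i - 1) (j - 1)"

text \<open>Corner sums of bisymmetric matrices with row sums 1 satisfy this with \<open>c = 1\<close>, and their
  perturbations with \<open>c = 0\<close>.\<close>

definition corner_function :: "nat \<Rightarrow> real \<Rightarrow> (nat \<Rightarrow> nat \<Rightarrow> real) \<Rightarrow> bool" where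
  "corner_function n c E \<longleftrightarrow>
    (\<forall>i\<le>n. \<forall>j\<le>n. E i j = E j i \<and> E (n - j) (n - i) = E i j + c * (real n - real i - real j)) \<and>
    (\<forall>j\<le>n. E 0 j = 0)"

text \<open>The last column is forced: the antidiagonal reflection sends \<open>(i, n)\<close> to
  \<open>(0, n - i)\<close>, where the value is 0.\<close>

lemma corner_functionD:
  assumes "corner_function n c E" "i \<le> n" "j \<le> n"
  shows "E i j = E j i" "E (n - j) (n - i) = E i j + c * (real n - real i - real j)"
    "E 0 j = 0" "E i 0 = 0" "E i n = c * real i"
proof -
  have *: "E i j = E j i \<and> E (n - j) (n - i) = E i j + c * (real n - real i - real j) \<and> E 0 j = 0"
    if "i \<le> n" "j \<le> n" for i j
    using assms(1) that unfolding corner_function_def by blast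
  from * assms show "E i j = E j i" "E (n - j) (n - i) = E i j + c * (real n - real i - real j)"
    "E 0 j = 0" by blast+
  show "E i 0 = 0" using *[OF assms(2) le0] *[OF le0 assms(2)] by metis
  have "E (n - n) (n - i) = E i n + c * (real n - real i - real n)"
    using *[OF assms(2) order.refl] by blast
  moreover have "E 0 (n - i) = 0" using *[OF le0 diff_le_self] by blast
  ultimately show "E i n = c * real i" by simp
qed

lemma row_sum_diff2:
  assumes E: "corner_function n c E" and "1 \<le> i" "i \<le> n" "j \<le> n"
  shows "row_sum (diff2 E) i j = E i j - E (i - 1) j"
  using assms(4)
proof (induction j)
  case 0
  have "E i 0 = 0" "E (i - 1) 0 = 0"
    using assms(3) by (auto intro!: corner_functionD(4)[OF E _ le0])
  then show ?case by simp
next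
  case (Suc j)
  then show ?case by (simp add: row_sum_Suc diff2_def)
qed

lemma bisymmetric_diff2:
  assumes E: "corner_function n c E"
  shows "bisymmetric n (diff2 E)"
proof -
  have sym: "diff2 E i j = diff2 E j i" if "i \<le> n" "j \<le> n" for i j
  proof -
    have "i - 1 \<le> n" "j - 1 \<le> n" using that by auto
    then have "E i j = E j i" "E i (j - 1) = E (j - 1) i" "E (i - 1) j = E j (i - 1)"
      "E (i - 1) (j - 1) = E (j - 1) (i - 1)"
      using that by (blast intro: corner_functionD(1)[OF E])+
    then show ?thesis unfolding diff2_def by linarith
  qed
  have refl: "diff2 E i j = diff2 E (n + 1 - j) (n + 1 - i)"
    if ij: "1 \<le> i" "i \<le> n" "1 \<le> j" "j \<le> n" for i j
  proof -
    define a b where "a = i - 1" and "b = j - 1"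
    then have ab: "i = Suc a" "j = Suc b" using ij by auto
    have "n + 1 - j - 1 = n - j" "n + 1 - i - 1 = n - i" "n + 1 - j = n - b" "n + 1 - i = n - a"
      using ab by auto
    moreover have "a \<le> n" "b \<le> n" using ij ab by auto
    ultimately show ?thesis
      using corner_functionD(2)[OF E ij(2) ij(4)] corner_functionD(2)[OF E ij(2), of b]
        corner_functionD(2)[OF E _ ij(4), of a] corner_functionD(2)[OF E, of a b]
      unfolding diff2_def ab by (simp add: algebra_simps)
  qed
  show ?thesis
    unfolding bisymmetric_def by (intro ballI conjI, rule sym, simp, simp, rule refl) simp_all
qed

definition corner_sum :: "(nat \<Rightarrow> nat \<Rightarrow> real) \<Rightarrow> nat \<Rightarrow> nat \<Rightarrow> real" where
  "corner_sum X i j = (\<Sum>a = 1..i. row_sum X a j)"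

lemma corner_sum_diff: "1 \<le> i \<Longrightarrow> corner_sum X i j - corner_sum X (i - 1) j = row_sum X i j"
  by (cases i) (simp_all add: corner_sum_def)

text \<open>For the antidiagonal reflection, each of the first \<open>n - j\<close> rows has total
  1, so its first \<open>n - i\<close> entries sum to 1 minus its last \<open>i\<close> entries. By
  the half turn the latter are the first \<open>i\<close> entries of one of the last
  \<open>n - j\<close> rows, and these rows contribute \<open>i\<close> minus a corner sum.\<close>

lemma corner_function_corner_sum:
  assumes X: "bisymmetric n X" and row: "\<And>i. 1 \<le> i \<Longrightarrow> i \<le> n \<Longrightarrow> row_sum X i n = 1"
  shows "corner_function n 1 (corner_sum X)"
proof -
  have sym: "corner_sum X i j = corner_sum X j i" if "i \<le> n" "j \<le> n" for i j
    unfolding corner_sum_def row_sum_def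
    by (subst sum.swap, intro sum.cong refl, rule bisymmetricD(1)[OF X]) (use that in auto)
  have full: "corner_sum X i n = real i" if "i \<le> n" for i
    using that by (simp add: corner_sum_def row)
  have refl: "corner_sum X (n - j) (n - i) = corner_sum X i j + 1 * (real n - real i - real j)"
    if ij: "i \<le> n" "j \<le> n" for i j
  proof -
    have "corner_sum X (n - j) (n - i) = (\<Sum>a = 1..n - j. 1 - row_sum X (n + 1 - a) i)"
      unfolding corner_sum_def
    proof (rule sum.cong)
      fix a assume "a \<in> {1..n - j}"
      then have "row_sum X (n + 1 - a) i = row_sum X a n - row_sum X a (n - i)" "row_sum X a n = 1"
        using ij by (auto intro!: row_sum_reflect[OF X] row simp del: One_nat_def)
      then show "row_sum X a (n - i) = 1 - row_sum X (n + 1 - a) i" by linarith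
    qed simp
    also have "\<dots> = real (n - j) - (\<Sum>a = 1..n - j. row_sum X (n + 1 - a) i)"
      by (simp add: sum_subtractf)
    also have "(\<Sum>a = 1..n - j. row_sum X (n + 1 - a) i) = (\<Sum>a = j + 1..n. row_sum X a i)"
      by (rule sum.reindex_bij_witness[of _ "\<lambda>b. n + 1 - b" "\<lambda>b. n + 1 - b"]) auto
    also have "(\<Sum>a = j + 1..n. row_sum X a i) = corner_sum X n i - corner_sum X j i"
    proof -
      have "{1..n} = {1..j} \<union> {j + 1..n}" using ij by auto
      then have "corner_sum X n i = corner_sum X j i + (\<Sum>a = j + 1..n. row_sum X a i)"
        unfolding corner_sum_def by (simp add: sum.union_disjoint)
      then show ?thesis by simp
    qed
    finally show ?thesis
      using sym[OF order.refl ij(1)] sym[OF ij(2,1)] full[OF ij(1)] ij by (simp add: of_nat_diff)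
  qed
  show ?thesis
    unfolding corner_function_def
    by (intro conjI allI impI sym refl) (simp_all add: corner_sum_def)
qed

section \<open>Inequality description of the core polytope\<close>

lemma linear_L_sum: "linear (L_sum n pos i j)"
  by (rule linearI)
    (simp_all add: L_sum_def entry_def sum.distrib sum_distrib_left algebra_simps)

lemma linear_M_sum: "linear (M_sum n pos j)"
  by (rule linearI) (simp_all add: M_sum_def entry_def sum.distrib sum_distrib_left)

text \<open>\<open>L_sum\<close> at \<open>j = n\<close> is the total of row \<open>i\<close>. This
  space turns out to be the affine hull of the polytope.\<close>

definition core_hull :: "nat \<Rightarrow> ('c::finite \<Rightarrow> nat \<times> nat) \<Rightarrow> (real ^ 'c) set" where
  "core_hull n pos = {Y. \<forall>i\<in>{1..n div 2}. L_sum n pos i n Y = 1}"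

definition core_polytope :: "nat \<Rightarrow> ('c::finite \<Rightarrow> nat \<times> nat) \<Rightarrow> (real ^ 'c) set" where
  "core_polytope n pos = {Y \<in> core_hull n pos.
     (\<forall>i\<in>{1..n div 2}. \<forall>j\<in>{1..n - 1}. L_sum n pos i j Y \<in> {0..1}) \<and>
     (odd n \<longrightarrow> (\<forall>j\<in>{1..n div 2}. M_sum n pos j Y \<in> {0..1}))}"

text \<open>For odd \<open>n\<close> the central entry is not in the core; it is determined by the middle row having
  sum 1.\<close>

definition full_matrix ::
  "nat \<Rightarrow> ('c::finite \<Rightarrow> nat \<times> nat) \<Rightarrow> real ^ 'c \<Rightarrow> nat \<Rightarrow> nat \<Rightarrow> real" where
  "full_matrix n pos Y i j =
     (if 2 * i = n + 1 \<and> 2 * j = n + 1 then 1 - 2 * M_sum n pos (n div 2) Y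
      else if i + j \<le> n + 1 then entry pos Y (min i j) (max i j)
      else entry pos Y (n + 1 - max i j) (n + 1 - min i j))"

lemma affine_core_hull: "affine (core_hull n pos)"
proof -
  have "core_hull n pos = (\<Inter>i\<in>{1..n div 2}. L_sum n pos i n -` {1})"
    by (auto simp: core_hull_def)
  moreover have "affine (L_sum n pos i n -` {1})" for i
    unfolding affine_def
    by (auto simp: linear_add[OF linear_L_sum] linear_cmul[OF linear_L_sum])
  ultimately show ?thesis by (auto intro!: affine_Inter)
qed

lemma core_polytope_eq_Inter:
  "core_polytope n pos = (\<Inter>i\<in>{1..n div 2}. L_sum n pos i n -` {1}) \<inter>
     (\<Inter>i\<in>{1..n div 2}. \<Inter>j\<in>{1..n - 1}. L_sum n pos i j -` {0..1}) \<inter>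
     (\<Inter>j\<in>{j. odd n \<and> j \<in> {1..n div 2}}. M_sum n pos j -` {0..1})"
  by (auto simp: core_polytope_def core_hull_def)

lemma convex_core_polytope: "convex (core_polytope n pos)"
  unfolding core_polytope_eq_Inter
  by (intro convex_Int convex_INT convex_linear_vimage linear_L_sum linear_M_sum) auto

lemma closed_core_polytope: "closed (core_polytope n pos)"
  unfolding core_polytope_eq_Inter
  by (intro closed_Int closed_INT ballI continuous_closed_vimage)
    (auto intro!: linear_continuous_at simp: linear_conv_bounded_linear[symmetric]
      linear_L_sum linear_M_sum)

lemma bisymmetric_full_matrix: "bisymmetric n (full_matrix n pos Y)"
  unfolding bisymmetric_def
proof (intro ballI conjI)
  fix i j assume ij: "i \<in> {1..n}" "j \<in> {1..n}"
  show "full_matrix n pos Y i j = full_matrix n pos Y j i"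
    by (simp add: full_matrix_def add.commute min.commute max.commute conj_commute)
  have mm: "min (n + 1 - j) (n + 1 - i) = n + 1 - max i j" "max (n + 1 - j) (n + 1 - i) = n + 1 - min i j"
    "n + 1 - (n + 1 - min i j) = min i j" "n + 1 - (n + 1 - max i j) = max i j"
    using ij by (auto simp: min_def max_def)
  have cent: "2 * (n + 1 - j) = n + 1 \<and> 2 * (n + 1 - i) = n + 1 \<longleftrightarrow> 2 * i = n + 1 \<and> 2 * j = n + 1"
    using ij by auto
  consider "i + j < n + 1" | "i + j = n + 1" | "i + j > n + 1" by linarith
  then show "full_matrix n pos Y i j = full_matrix n pos Y (n + 1 - j) (n + 1 - i)"
  proof cases
    case 2
    then have e: "n + 1 - max i j = min i j" "n + 1 - min i j = max i j"
      by (auto simp: min_def max_def)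
    have le: "i + j \<le> n + 1" "n + 1 - j + (n + 1 - i) \<le> n + 1" using 2 by auto
    show ?thesis unfolding full_matrix_def mm cent by (simp only: e le if_True)
  next
    case 1
    then have "\<not> (n + 1 - j + (n + 1 - i) \<le> n + 1)" using ij by auto
    then show ?thesis using 1 unfolding full_matrix_def mm cent by simp
  next
    case 3
    then have "n + 1 - j + (n + 1 - i) \<le> n + 1" using ij by auto
    then show ?thesis using 3 unfolding full_matrix_def mm cent by simp
  qed
qed

section \<open>Core coordinates as partial sums of rows\<close>

context
  fixes n :: nat and pos :: "'c::finite \<Rightarrow> nat \<times> nat"
  assumes pos: "bij_betw pos UNIV (core_positions n)"
begin

lemma entry_core:
  assumes "(i, j) \<in> core_positions n"
  shows "entry pos (core pos X) i j = X i j"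
proof -
  have "pos (inv pos (i, j)) = (i, j)"
    using assms pos by (simp add: bij_betw_def f_inv_into_f)
  then show ?thesis by (simp add: entry_def core_def)
qed

lemma component_eq_entry:
  obtains i j where "pos c = (i, j)" "(i, j) \<in> core_positions n" "Y $ c = entry pos Y i j"
proof -
  have "inv pos (pos c) = c" using pos by (simp add: bij_betw_def)
  moreover have "pos c \<in> core_positions n" using pos by (auto simp: bij_betw_def)
  ultimately show ?thesis using that by (cases "pos c") (auto simp: entry_def)
qed

lemma core_full_matrix [simp]: "core pos (full_matrix n pos Y) = Y"
proof -
  have "core pos (full_matrix n pos Y) $ c = Y $ c" for c
  proof -
    obtain i j where ij: "pos c = (i, j)" "(i, j) \<in> core_positions n" "Y $ c = entry pos Y i j"
      by (rule component_eq_entry)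
    then have "full_matrix n pos Y i j = entry pos Y i j"
      by (auto simp: core_positions_def full_matrix_def)
    then show ?thesis using ij by (simp add: core_def)
  qed
  then show ?thesis by (simp add: vec_eq_iff)
qed

text \<open>The three sums follow row \<open>i\<close> from left to right. Left of the diagonal its
  entries are found in column \<open>i\<close> by transposition, right of the antidiagonal in column
  \<open>n + 1 - i\<close> by the other reflection; only the middle stretch lies in row
  \<open>i\<close> of the core.\<close>

lemma L_sum_core:
  assumes X: "bisymmetric n X" and i: "i \<in> {1..n div 2}" and j: "j \<le> n"
  shows "L_sum n pos i j (core pos X) = row_sum X i j"
proof -
  have 1: "(\<Sum>i' = 1..min (i - 1) j. entry pos (core pos X) i' i) = (\<Sum>b = 1..min (i - 1) j. X i b)"
  proof (rule sum.cong)
    fix b assume b: "b \<in> {1..min (i - 1) j}"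
    then have "entry pos (core pos X) b i = X b i"
      using i by (intro entry_core) (auto simp: core_positions_def)
    also have "\<dots> = X i b" by (rule bisymmetricD(1)[OF X]) (use b i in auto)
    finally show "entry pos (core pos X) b i = X i b" .
  qed simp
  have 2: "(\<Sum>j' = i..min (n + 1 - i) j. entry pos (core pos X) i j') =
      (\<Sum>b = i..min (n + 1 - i) j. X i b)"
    using i by (intro sum.cong refl entry_core) (auto simp: core_positions_def)
  have 3: "(\<Sum>i' = n - i + 2..j. entry pos (core pos X) (n + 1 - i') (n + 1 - i)) =
      (\<Sum>b = n - i + 2..j. X i b)"
  proof (rule sum.cong)
    fix b assume b: "b \<in> {n - i + 2..j}"
    then have "entry pos (core pos X) (n + 1 - b) (n + 1 - i) = X (n + 1 - b) (n + 1 - i)"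
      using i j by (intro entry_core) (auto simp: core_positions_def)
    also have "\<dots> = X i b"
      by (rule bisymmetricD(2)[OF X, symmetric]) (use b i j in auto)
    finally show "entry pos (core pos X) (n + 1 - b) (n + 1 - i) = X i b" .
  qed simp
  have "{1..j} = {1..min (i - 1) j} \<union> {i..min (n + 1 - i) j} \<union> {n - i + 2..j}"
    using i j by auto
  moreover have "{1..min (i - 1) j} \<inter> {i..min (n + 1 - i) j} = {}"
    "({1..min (i - 1) j} \<union> {i..min (n + 1 - i) j}) \<inter> {n - i + 2..j} = {}"
    using i by auto
  ultimately have "row_sum X i j = (\<Sum>b = 1..min (i - 1) j. X i b) +
      (\<Sum>b = i..min (n + 1 - i) j. X i b) + (\<Sum>b = n - i + 2..j. X i b)"
    unfolding row_sum_def by (simp add: sum.union_disjoint)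
  then show ?thesis unfolding L_sum_def 1 2 3 by simp
qed

lemma M_sum_core:
  assumes X: "bisymmetric n X" and n: "odd n" and j: "j \<le> n div 2"
  shows "M_sum n pos j (core pos X) = row_sum X (n div 2 + 1) j"
  unfolding M_sum_def row_sum_def
proof (rule sum.cong)
  fix i assume i: "i \<in> {1..j}"
  have n2: "n = 2 * (n div 2) + 1" using n by presburger
  have "entry pos (core pos X) i (n div 2 + 1) = X i (n div 2 + 1)"
    using i j n2 by (intro entry_core) (auto simp: core_positions_def)
  also have "\<dots> = X (n div 2 + 1) i"
    by (rule bisymmetricD(1)[OF X]) (use i j n2 in auto)
  finally show "entry pos (core pos X) i (n div 2 + 1) = X (n div 2 + 1) i" .
qed simp

lemma L_sum_eq_row_sum:
  "i \<in> {1..n div 2} \<Longrightarrow> j \<le> n \<Longrightarrow> L_sum n pos i j Y = row_sum (full_matrix n pos Y) i j"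
  using L_sum_core[OF bisymmetric_full_matrix[of n pos Y], of i j] by simp

lemma M_sum_eq_row_sum:
  "odd n \<Longrightarrow> j \<le> n div 2 \<Longrightarrow> M_sum n pos j Y = row_sum (full_matrix n pos Y) (n div 2 + 1) j"
  using M_sum_core[OF bisymmetric_full_matrix[of n pos Y], of j] by simp

lemma row_cases [consumes 2, case_names upper middle lower]:
  assumes "1 \<le> i" "i \<le> n"
  obtains "i \<in> {1..n div 2}" | "odd n" "i = n div 2 + 1" | "n + 1 - i \<in> {1..n div 2}"
proof -
  consider "i \<le> n div 2" | "2 * i = n + 1" | "n + 1 - i \<le> n div 2" by linarith
  then show ?thesis
  proof cases
    case 2
    then have "odd n" "i = n div 2 + 1" by presburger+
    then show ?thesis by (rule that(2))
  qed (use that assms in auto)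
qed

lemma full_matrix_total:
  assumes Y: "Y \<in> core_hull n pos" and i: "1 \<le> i" "i \<le> n"
  shows "row_sum (full_matrix n pos Y) i n = 1"
  using i
proof (cases i rule: row_cases)
  case upper
  then show ?thesis using Y L_sum_eq_row_sum[of i n Y] by (simp add: core_hull_def)
next
  case middle
  let ?X = "full_matrix n pos Y" and ?k = "n div 2"
  have n: "n = 2 * ?k + 1" using middle by presburger
  \<comment> \<open>The middle row is a palindrome, so its total is twice the sum of its first half
    plus the central entry; hence the value \<open>1 - 2 * M_sum\<close> given to that
    entry.\<close>
  have "row_sum ?X (n + 1 - i) ?k = row_sum ?X i n - row_sum ?X i (n - ?k)"
    by (rule row_sum_reflect[OF bisymmetric_full_matrix i]) simp
  moreover have "n + 1 - i = i" "n - ?k = Suc ?k" using middle(2) n by arith+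
  moreover have "?X i (Suc ?k) = 1 - 2 * M_sum n pos ?k Y"
    using middle n by (simp add: full_matrix_def)
  ultimately show ?thesis
    using M_sum_eq_row_sum[of ?k Y] middle by (simp add: row_sum_Suc)
next
  case lower
  have "row_sum (full_matrix n pos Y) (n + 1 - (n + 1 - i)) n =
      row_sum (full_matrix n pos Y) (n + 1 - i) n"
    using row_sum_reflect[OF bisymmetric_full_matrix, of "n + 1 - i" n n pos Y] i by simp
  then show ?thesis
    using Y lower i L_sum_eq_row_sum[of "n + 1 - i" n Y] by (simp add: core_hull_def)
qed

text \<open>The half turn replaces a partial sum by 1 minus a partial sum, so bounds by 0 and 1 pass
  from the upper rows to the lower ones and from the left half of the middle row to its right
  half.\<close>

lemma row_sum_full_matrix_bounds:
  assumes Y: "Y \<in> core_polytope n pos" and i: "1 \<le> i" "i \<le> n" and j: "j \<le> n"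
  shows "row_sum (full_matrix n pos Y) i j \<in> {0..1}"
proof -
  let ?X = "full_matrix n pos Y" and ?k = "n div 2"
  have total: "row_sum ?X i n = 1" if "1 \<le> i" "i \<le> n" for i
    using Y that by (intro full_matrix_total) (auto simp: core_polytope_def)
  have bound: "row_sum ?X i j \<in> {0..1}" if i: "i \<in> {1..?k}" and j: "j \<le> n" for i j
  proof (cases "j = 0 \<or> j = n")
    case True
    then show ?thesis using total[of i] i by auto
  next
    case False
    then have "L_sum n pos i j Y \<in> {0..1}"
      using Y i j by (auto simp: core_polytope_def)
    then show ?thesis using L_sum_eq_row_sum[OF i j] by simp
  qed
  show ?thesis using i
  proof (cases i rule: row_cases)
    case upper
    then show ?thesis using bound j by blast
  next
    case middle
    have half: "row_sum ?X i j \<in> {0..1}" if "j \<le> ?k" for j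
    proof (cases "j = 0")
      case False
      then have "M_sum n pos j Y \<in> {0..1}"
        using Y that middle(1) by (auto simp: core_polytope_def)
      then show ?thesis using M_sum_eq_row_sum[OF middle(1) that] middle(2) by simp
    qed simp
    show ?thesis
    proof (cases "j \<le> ?k")
      case False
      have n: "n = 2 * ?k + 1" using middle by presburger
      have "n + 1 - i = i" using middle(2) n by arith
      then have "row_sum ?X i j = 1 - row_sum ?X i (n - j)"
        using row_sum_reflect[OF bisymmetric_full_matrix i j, of pos Y] total[OF i] by simp
      moreover have "n - j \<le> ?k" using False n by arith
      ultimately show ?thesis using half[of "n - j"] by auto
    qed (rule half)
  next
    case lower
    have "n + 1 - (n + 1 - i) = i" using i by simp
    then have "row_sum ?X i j = 1 - row_sum ?X (n + 1 - i) (n - j)"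
      using row_sum_reflect[OF bisymmetric_full_matrix, of "n + 1 - i" n j pos Y]
        total[of "n + 1 - i"] i j by simp
    then show ?thesis using bound[OF lower, of "n - j"] by auto
  qed
qed

lemma core_mem_core_hull:
  assumes "bisymmetric n X" "\<And>i. i \<in> {1..n div 2} \<Longrightarrow> row_sum X i n = 1"
  shows "core pos X \<in> core_hull n pos"
  using assms by (simp add: core_hull_def L_sum_core)

lemma DASASM_core_mem:
  assumes X: "DASASM n X"
  shows "core pos X \<in> core_polytope n pos"
proof -
  have bi: "bisymmetric n X"
    and row: "\<And>i j. i \<in> {1..n} \<Longrightarrow> j \<le> n \<Longrightarrow> row_sum X i j \<in> {0..1}"
    and total: "\<And>i. i \<in> {1..n} \<Longrightarrow> row_sum X i n = 1"
    using X unfolding DASASM_iff by blast+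
  have "core pos X \<in> core_hull n pos"
    by (rule core_mem_core_hull[OF bi total]) auto
  moreover have "L_sum n pos i j (core pos X) \<in> {0..1}"
    if "i \<in> {1..n div 2}" "j \<in> {1..n - 1}" for i j
    using that L_sum_core[OF bi that(1), of j] row[of i j] by auto
  moreover have "M_sum n pos j (core pos X) \<in> {0..1}" if "odd n" "j \<in> {1..n div 2}" for j
  proof -
    have "n div 2 + 1 \<in> {1..n}" using that by (auto elim: oddE)
    then show ?thesis
      using that M_sum_core[OF bi that(1), of j] row[of "n div 2 + 1" j] by auto
  qed
  ultimately show ?thesis by (auto simp: core_polytope_def)
qed

text \<open>Each core entry is a difference of two consecutive partial sums in
  \<open>{0..1}\<close>. Compactness is what allows recovering the polytope from its extreme
  points.\<close>

lemma compact_core_polytope: "compact (core_polytope n pos)"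
proof -
  have "norm Y \<le> real CARD('c)" if Y: "Y \<in> core_polytope n pos" for Y
  proof -
    have "\<bar>Y $ c\<bar> \<le> 1" for c
    proof -
      let ?X = "full_matrix n pos Y"
      obtain i j where ij: "pos c = (i, j)" "(i, j) \<in> core_positions n"
        by (rule component_eq_entry)
      have "Y $ c = core pos ?X $ c" by simp
      then have "Y $ c = ?X i j" using ij(1) by (simp add: core_def)
      also have "\<dots> = row_sum ?X i j - row_sum ?X i (j - 1)"
        using ij(2) by (intro row_sum_diff[symmetric]) (auto simp: core_positions_def)
      finally have "Y $ c = row_sum ?X i j - row_sum ?X i (j - 1)" .
      moreover have "row_sum ?X i j \<in> {0..1}" "row_sum ?X i (j - 1) \<in> {0..1}"
        using ij(2) by (intro row_sum_full_matrix_bounds[OF Y]; auto simp: core_positions_def)+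
      ultimately show ?thesis by auto
    qed
    then have "(\<Sum>c\<in>UNIV. \<bar>Y $ c\<bar>) \<le> (\<Sum>c\<in>(UNIV::'c set). 1)" by (intro sum_mono)
    then show ?thesis using norm_le_l1_cart[of Y] by simp
  qed
  then have "bounded (core_polytope n pos)" by (auto simp: bounded_iff)
  then show ?thesis using closed_core_polytope by (simp add: compact_eq_bounded_closed)
qed

end

section \<open>Integrality\<close>

text \<open>A bound can be tight only at an integral value, which is then frozen; other values have
  room on both sides. The filter form lets one small \<open>e\<close> serve finitely many
  bounds.\<close>

lemma eventually_at_right_shift_unit_interval:
  fixes v w :: real
  assumes v: "v \<in> {0..1}" and w: "w = 0 \<or> \<bar>w\<bar> = 1" and int: "v \<in> \<int> \<Longrightarrow> w = 0"
  shows "\<forall>\<^sub>F e in at_right 0. v + e * w \<in> {0..1} \<and> v - e * w \<in> {0..1}"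
proof (cases "w = 0")
  case True
  then show ?thesis using v by simp
next
  case False
  then have "v \<noteq> 0" "v \<noteq> 1" using int by auto
  then have "0 < min v (1 - v)" using v by auto
  then have "\<forall>\<^sub>F e in at_right 0. e \<in> {0<..<min v (1 - v)}"
    by (rule eventually_at_right_real)
  then show ?thesis
  proof eventually_elim
    case (elim e)
    then have "\<bar>e * w\<bar> < min v (1 - v)" using w False by (auto simp: abs_mult)
    then show ?case by auto
  qed
qed

context
  fixes n :: nat and pos :: "'c::finite \<Rightarrow> nat \<times> nat"
  assumes pos: "bij_betw pos UNIV (core_positions n)"
begin

lemma corner_function_full_matrix:
  assumes "Y \<in> core_hull n pos"
  shows "corner_function n 1 (corner_sum (full_matrix n pos Y))"
  using assms
  by (intro corner_function_corner_sum bisymmetric_full_matrix full_matrix_total[OF pos])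

text \<open>If some corner sum \<open>x\<close> of \<open>Y\<close> is not an integer, then all corner sums congruent to \<open>x\<close>
  modulo 1 can be shifted simultaneously by a small amount in either direction without leaving
  the polytope, since a constraint relating a shifted to an unshifted one cannot be tight.\<close>

lemma corner_sum_extreme_point:
  assumes Y: "Y extreme_point_of core_polytope n pos" and ij: "i \<le> n" "j \<le> n"
  shows "corner_sum (full_matrix n pos Y) i j \<in> \<int>"
proof (rule ccontr)
  let ?X = "full_matrix n pos Y" and ?k = "n div 2"
  define H where "H = corner_sum ?X"
  assume nonint: "corner_sum ?X i j \<notin> \<int>"
  have YP: "Y \<in> core_polytope n pos" using Y by (simp add: extreme_point_of_def)
  then have Yh: "Y \<in> core_hull n pos" by (simp add: core_polytope_def)
  have H: "corner_function n 1 H"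
    unfolding H_def by (rule corner_function_full_matrix[OF Yh])
  \<comment> \<open>A representative in the upper half is needed: the sums \<open>L\<close> only see
    rows up to \<open>n div 2\<close>, and they must detect that the perturbation is
    nonzero.\<close>
  obtain p q where pq: "p \<le> ?k" "q \<le> n" "H p q \<notin> \<int>"
  proof -
    consider "i \<le> ?k" | "j \<le> ?k" | "n - j \<le> ?k" by linarith
    then show ?thesis
    proof cases
      case 1
      then show ?thesis using that ij nonint by (simp add: H_def)
    next
      case 2
      have "H j i \<notin> \<int>" using corner_functionD(1)[OF H ij] nonint by (simp add: H_def)
      then show ?thesis using that 2 ij by blast
    next
      case 3
      have "H (n - j) (n - i) = H i j + of_int (int n - int i - int j)"
        using corner_functionD(2)[OF H ij] by simp
      then have "H (n - j) (n - i) - of_int (int n - int i - int j) = H i j" by simp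
      then have "H (n - j) (n - i) \<notin> \<int>"
        using nonint Ints_diff[OF _ Ints_of_int] unfolding H_def by metis
      then show ?thesis using that[of "n - j" "n - i"] 3 by simp
    qed
  qed
  define d where "d a b = (if H a b - H p q \<in> \<int> then 1 else 0 :: real)" for a b
  have d_eq: "d a b = d a' b'" if "H a b - H a' b' \<in> \<int>" for a b a' b'
  proof -
    have "H a b - H p q \<in> \<int> \<longleftrightarrow> H a' b' - H p q \<in> \<int>"
      using Ints_diff[OF _ that, of "H a b - H p q"] Ints_add[OF _ that, of "H a' b' - H p q"]
      by auto
    then show ?thesis by (simp add: d_def)
  qed
  have d: "corner_function n 0 d"
    unfolding corner_function_def
  proof (intro conjI allI impI)
    fix a b assume ab: "a \<le> n" "b \<le> n"
    show "d a b = d b a" by (rule d_eq) (use corner_functionD(1)[OF H ab] in simp)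
    \<comment> \<open>Reflection changes corner sums by integers, so congruence classes modulo 1 are
      invariant and \<open>d\<close> reflects without a correction term.\<close>
    have "H (n - b) (n - a) - H a b = of_int (int n - int a - int b)"
      using corner_functionD(2)[OF H ab] by simp
    then have "d (n - b) (n - a) = d a b" by (intro d_eq) (metis Ints_of_int)
    then show "d (n - b) (n - a) = d a b + 0 * (real n - real a - real b)" by simp
  next
    fix b assume "b \<le> n"
    then have "H 0 b = 0" using corner_functionD(3)[OF H le0] by blast
    then show "d 0 b = 0" using pq(3) minus_in_Ints_iff[of "H p q"] by (simp add: d_def)
  qed
  define Z where "Z = core pos (diff2 d)"
  have L_Y: "L_sum n pos a b Y = H a b - H (a - 1) b" if "a \<in> {1..?k}" "b \<le> n" for a b
    using that L_sum_eq_row_sum[OF pos that] corner_sum_diff[of a ?X b] by (simp add: H_def)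
  have L_Z: "L_sum n pos a b Z = d a b - d (a - 1) b" if "a \<in> {1..?k}" "b \<le> n" for a b
  proof -
    have "1 \<le> a" "a \<le> n" using that by auto
    then show ?thesis
      using that L_sum_core[OF pos bisymmetric_diff2[OF d] that] row_sum_diff2[OF d, of a b]
      by (simp add: Z_def)
  qed
  have M_Y: "M_sum n pos b Y = H (?k + 1) b - H ?k b" if "odd n" "b \<le> ?k" for b
    using M_sum_eq_row_sum[OF pos that] corner_sum_diff[of "?k + 1" ?X b] by (simp add: H_def)
  have M_Z: "M_sum n pos b Z = d (?k + 1) b - d ?k b" if "odd n" "b \<le> ?k" for b
    using M_sum_core[OF pos bisymmetric_diff2[OF d] that] row_sum_diff2[OF d, of "?k + 1" b] that
    by (simp add: Z_def odd_pos Suc_le_eq)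
  have shift: "\<forall>\<^sub>F e in at_right 0. v + e * w \<in> {0..1} \<and> v - e * w \<in> {0..1}"
    if "v \<in> {0..1}" "v = H a b - H a' b'" "w = d a b - d a' b'" for v w a b a' b'
  proof (rule eventually_at_right_shift_unit_interval)
    show "w = 0 \<or> \<bar>w\<bar> = 1" using that(3) by (simp add: d_def)
    show "w = 0" if "v \<in> \<int>"
      using d_eq[of a b a' b'] that \<open>v = _\<close> \<open>w = _\<close> by simp
  qed (rule that)
  define inside where
    "inside v w e \<longleftrightarrow> v + e * w \<in> {0..1} \<and> v - e * w \<in> {0..1}" for v w e :: real
  have "\<forall>\<^sub>F e in at_right 0. \<forall>a\<in>{1..?k}. \<forall>b\<in>{1..n - 1}.
      inside (L_sum n pos a b Y) (L_sum n pos a b Z) e"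
  proof (intro eventually_ball_finite ballI finite_atLeastAtMost)
    fix a b assume a: "a \<in> {1..?k}" and b: "b \<in> {1..n - 1}"
    then have "b \<le> n" by auto
    then show "\<forall>\<^sub>F e in at_right 0. inside (L_sum n pos a b Y) (L_sum n pos a b Z) e"
      unfolding inside_def using a b YP
      by (intro shift[OF _ L_Y L_Z]) (auto simp: core_polytope_def)
  qed
  moreover have "\<forall>\<^sub>F e in at_right 0. \<forall>b\<in>{b. odd n \<and> b \<in> {1..?k}}.
      inside (M_sum n pos b Y) (M_sum n pos b Z) e"
  proof (intro eventually_ball_finite ballI)
    fix b assume b: "b \<in> {b. odd n \<and> b \<in> {1..?k}}"
    then show "\<forall>\<^sub>F e in at_right 0. inside (M_sum n pos b Y) (M_sum n pos b Z) e"
      unfolding inside_def using YP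
      by (intro shift[OF _ M_Y M_Z]) (auto simp: core_polytope_def)
  qed simp
  moreover have "\<forall>\<^sub>F e in at_right (0::real). 0 < e" by (rule eventually_at_right_less)
  ultimately have "\<forall>\<^sub>F e in at_right 0. 0 < e \<and>
      (\<forall>a\<in>{1..?k}. \<forall>b\<in>{1..n - 1}. inside (L_sum n pos a b Y) (L_sum n pos a b Z) e) \<and>
      (\<forall>b\<in>{b. odd n \<and> b \<in> {1..?k}}. inside (M_sum n pos b Y) (M_sum n pos b Z) e)"
    by eventually_elim blast
  then obtain e where e: "0 < e"
      "\<And>a b. a \<in> {1..?k} \<Longrightarrow> b \<in> {1..n - 1} \<Longrightarrow> inside (L_sum n pos a b Y) (L_sum n pos a b Z) e"
      "\<And>b. odd n \<Longrightarrow> b \<in> {1..?k} \<Longrightarrow> inside (M_sum n pos b Y) (M_sum n pos b Z) e"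
    using eventually_happens'[OF trivial_limit_at_right_real] by blast
  have total: "L_sum n pos a n Z = 0" if "a \<in> {1..?k}" for a
  proof -
    have "a \<le> n" "a - 1 \<le> n" using that by auto
    then show ?thesis
      using L_Z[OF that order.refl] corner_functionD(5)[OF d _ order.refl] by simp
  qed
  note lin = linear_add[OF linear_L_sum] linear_diff[OF linear_L_sum] linear_cmul[OF linear_L_sum]
    linear_add[OF linear_M_sum] linear_diff[OF linear_M_sum] linear_cmul[OF linear_M_sum]
  have plus: "Y + e *\<^sub>R Z \<in> core_polytope n pos"
    using Yh e(2,3) total unfolding core_polytope_def core_hull_def inside_def by (simp add: lin)
  have minus: "Y - e *\<^sub>R Z \<in> core_polytope n pos"
    using Yh e(2,3) total unfolding core_polytope_def core_hull_def inside_def by (simp add: lin)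
  have "Z \<noteq> 0"
  proof
    assume Z0: "Z = 0"
    \<comment> \<open>If \<open>Z\<close> vanished, \<open>d\<close> would have no vertical steps in
      column \<open>q\<close> down to row \<open>n div 2\<close>; starting from 0 on row 0 it could
      not reach the value 1 at \<open>(p, q)\<close>.\<close>
    have "d a q = 0" if "a \<le> ?k" for a
      using that
    proof (induction a)
      case 0
      show ?case by (rule corner_functionD(3)[OF d le0 pq(2)])
    next
      case (Suc a)
      then show ?case
        using L_Z[of "Suc a" q] pq(2) linear_0[OF linear_L_sum, of n pos "Suc a" q] by (simp add: Z0)
    qed
    then have "d p q = 0" using pq(1) .
    then show False by (simp add: d_def)
  qed
  then have "Y + e *\<^sub>R Z \<noteq> Y - e *\<^sub>R Z" using e(1) by (simp add: eq_neg_iff_add_eq_0 scaleR_left_distrib[symmetric])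
  then have "midpoint (Y + e *\<^sub>R Z) (Y - e *\<^sub>R Z) \<in> open_segment (Y + e *\<^sub>R Z) (Y - e *\<^sub>R Z)"
    by simp
  moreover have "midpoint (Y + e *\<^sub>R Z) (Y - e *\<^sub>R Z) = Y"
    by (simp add: midpoint_def scaleR_2[symmetric])
  ultimately show False using Y plus minus unfolding extreme_point_of_def by metis
qed

text \<open>Integral corner sums give integral entries, and an entry is a difference of two partial
  sums in \<open>{0..1}\<close>, which leaves only -1, 0 and 1.\<close>

lemma DASASM_full_matrix_extreme_point:
  assumes Y: "Y extreme_point_of core_polytope n pos"
  shows "DASASM n (full_matrix n pos Y)"
proof -
  let ?X = "full_matrix n pos Y"
  have YP: "Y \<in> core_polytope n pos" using Y by (simp add: extreme_point_of_def)
  then have Yh: "Y \<in> core_hull n pos" by (simp add: core_polytope_def)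
  have row: "row_sum ?X i j \<in> {0..1}" if "1 \<le> i" "i \<le> n" "j \<le> n" for i j
    by (rule row_sum_full_matrix_bounds[OF pos YP that])
  have row_int: "row_sum ?X i j \<in> \<int>" if "1 \<le> i" "i \<le> n" "j \<le> n" for i j
  proof -
    have "corner_sum ?X i j - corner_sum ?X (i - 1) j \<in> \<int>"
      using that by (intro Ints_diff corner_sum_extreme_point[OF Y]) auto
    then show ?thesis using corner_sum_diff[OF that(1)] by simp
  qed
  have "?X i j \<in> {0, 1, -1}" if "i \<in> {1..n}" "j \<in> {1..n}" for i j
  proof -
    have eq: "?X i j = row_sum ?X i j - row_sum ?X i (j - 1)"
      using that by (intro row_sum_diff[symmetric]) auto
    have j: "1 \<le> i" "i \<le> n" "j \<le> n" "j - 1 \<le> n" using that by auto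
    have "\<bar>?X i j\<bar> \<le> 1" unfolding eq using row[OF j(1-3)] row[OF j(1,2,4)] by auto
    moreover obtain m where m: "?X i j = of_int m"
      using Ints_diff[OF row_int[OF j(1-3)] row_int[OF j(1,2,4)]] unfolding eq[symmetric]
      by (auto elim: Ints_cases)
    ultimately have "\<bar>m\<bar> \<le> 1" by (simp flip: of_int_abs)
    then have "m = 0 \<or> m = 1 \<or> m = -1" by auto
    then show ?thesis using m by auto
  qed
  then show ?thesis
    unfolding DASASM_iff
    using bisymmetric_full_matrix row full_matrix_total[OF pos Yh] by simp
qed

lemma P_core_eq_core_polytope: "P_core n pos = core_polytope n pos"
proof
  show "P_core n pos \<subseteq> core_polytope n pos"
    unfolding P_core_def
    using DASASM_core_mem[OF pos] by (intro hull_minimal convex_core_polytope) auto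
  have "{Y. Y extreme_point_of core_polytope n pos} \<subseteq> {core pos X | X. DASASM n X}"
  proof
    fix Y assume "Y \<in> {Y. Y extreme_point_of core_polytope n pos}"
    then have "DASASM n (full_matrix n pos Y)" by (simp add: DASASM_full_matrix_extreme_point)
    moreover have "Y = core pos (full_matrix n pos Y)" using core_full_matrix[OF pos] by simp
    ultimately show "Y \<in> {core pos X | X. DASASM n X}" by blast
  qed
  then have "convex hull {Y. Y extreme_point_of core_polytope n pos} \<subseteq> P_core n pos"
    unfolding P_core_def by (rule hull_mono)
  then show "core_polytope n pos \<subseteq> P_core n pos"
    using Krein_Milman_Minkowski[OF compact_core_polytope[OF pos] convex_core_polytope] by simp
qed

end

section \<open>Facets of a polytope given by irredundant inequalities\<close>

lemma facets_bij_betw_constraints: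
  fixes f :: "'i \<Rightarrow> 'a::euclidean_space \<Rightarrow> real" and c :: "'i \<Rightarrow> real"
  assumes fin: "finite I" and W: "affine W" and lin: "\<And>i. i \<in> I \<Longrightarrow> linear (f i)"
    and P: "P = {x \<in> W. \<forall>i\<in>I. c i \<le> f i x}"
    and z: "z \<in> W" "\<And>i. i \<in> I \<Longrightarrow> c i < f i z"
    and tight: "\<And>i. i \<in> I \<Longrightarrow> \<exists>w\<in>W. f i w = c i \<and> (\<forall>j\<in>I - {i}. c j < f j w)"
  shows "bij_betw (\<lambda>i. {x \<in> P. f i x = c i}) I {F. F facet_of P}"
proof -
  \<comment> \<open>The gradient of \<open>f i\<close>, negated because half-spaces are written with
    an upper bound.\<close>
  define a where "a i = - adjoint (f i) 1" for i
  have a: "a i \<bullet> x = - f i x" if "i \<in> I" for i x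
    using adjoint_works[OF lin[OF that], of x 1] by (simp add: a_def inner_commute)
  have open_slack: "open {x. \<forall>i\<in>J. c i < f i x}" if "J \<subseteq> I" for J
  proof -
    have "{x. \<forall>i\<in>J. c i < f i x} = (\<Inter>i\<in>J. {x. a i \<bullet> x < - c i})"
      using a that by fastforce
    moreover have "finite J" using fin that by (rule rev_finite_subset)
    ultimately show ?thesis by (simp add: open_INT open_halfspace_lt)
  qed
  have hull: "affine hull P = W"
  proof
    show "affine hull P \<subseteq> W" using W P by (intro hull_minimal) auto
    have "affine hull (W \<inter> {x. \<forall>i\<in>I. c i < f i x}) = affine hull W"
      by (rule affine_hull_affine_Int_open[OF W open_slack]) (use z in auto)
    also have "\<dots> = W" using W by (simp add: affine_hull_eq)
    finally have "affine hull (W \<inter> {x. \<forall>i\<in>I. c i < f i x}) = W" .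
    moreover have "W \<inter> {x. \<forall>i\<in>I. c i < f i x} \<subseteq> P" using P by force
    ultimately show "W \<subseteq> affine hull P" by (metis hull_mono)
  qed
  define half where "half i = {x. a i \<bullet> x \<le> - c i}" for i
  have half: "x \<in> half i \<longleftrightarrow> c i \<le> f i x" if "i \<in> I" for i x
    using a[OF that] by (simp add: half_def)
  txt \<open>Moving from a point where only constraint \<open>i\<close> is tight slightly away from the
    interior point \<open>z\<close> violates constraint \<open>i\<close> and no other.\<close>
  have violate: "\<exists>v\<in>W. v \<notin> half i \<and> (\<forall>j\<in>I - {i}. v \<in> half j)" if i: "i \<in> I" for i
  proof -
    obtain w where w: "w \<in> W" "f i w = c i" "\<forall>j\<in>I - {i}. c j < f j w"
      using tight[OF i] by blast
    let ?S = "{x. \<forall>j\<in>I - {i}. c j < f j x}"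
    obtain e where e: "0 < e" "ball w e \<subseteq> ?S"
      using w open_slack[of "I - {i}"] by (auto simp: open_contains_ball)
    \<comment> \<open>The added 1 keeps the denominator positive whatever \<open>w - z\<close> is,
      and the factor 2 gives a displacement of at most \<open>e / 2\<close>, strictly inside the
      ball.\<close>
    define t where "t = e / (2 * (norm (w - z) + 1))"
    have pos: "0 < norm (w - z) + 1" by (smt (verit) norm_ge_zero)
    then have t: "0 < t" using e by (simp add: t_def)
    define v where "v = (1 + t) *\<^sub>R w + (- t) *\<^sub>R z"
    have "v \<in> W" unfolding v_def by (rule mem_affine[OF W w(1) z(1)]) simp
    moreover have "v \<notin> half i"
    proof -
      have "f i v = (1 + t) * f i w - t * f i z"
        unfolding v_def using lin[OF i] by (simp add: linear_diff linear_cmul)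
      also have "\<dots> = c i - t * (f i z - c i)" using w by (simp add: algebra_simps)
      also have "\<dots> < c i" using t z(2)[OF i] by simp
      finally show ?thesis using half[OF i] by simp
    qed
    moreover have "v \<in> ?S"
    proof -
      have "dist w v = t * norm (w - z)"
      proof -
        have "w - v = (- t) *\<^sub>R (w - z)" by (simp add: v_def algebra_simps)
        then show ?thesis using t by (simp add: dist_norm)
      qed
      also have "\<dots> \<le> e / 2"
        using e pos by (simp add: t_def field_simps)
      also have "\<dots> < e" using e by simp
      finally show ?thesis using e by auto
    qed
    then have "\<forall>j\<in>I - {i}. v \<in> half j" using half by (simp add: less_imp_le)
    ultimately show ?thesis by blast
  qed
  have inj: "inj_on half I"
    by (rule inj_onI) (use violate in \<open>metis DiffI empty_iff insert_iff\<close>)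
  \<comment> \<open>The facet criterion is indexed by the half-spaces themselves, so the constraint
    has to be recovered from its half-space.\<close>
  define g where "g = the_inv_into I half"
  have g: "g (half i) = i" if "i \<in> I" for i
    unfolding g_def using the_inv_into_f_f[OF inj that] .
  have P_eq: "P = affine hull P \<inter> \<Inter>(half ` I)"
    unfolding hull using P half by auto
  have facet: "F facet_of P \<longleftrightarrow> (\<exists>h. h \<in> half ` I \<and> F = P \<inter> {x. a (g h) \<bullet> x = - c (g h)})" for F
  proof (rule facet_of_polyhedron_explicit[OF _ P_eq])
    show "finite (half ` I)" using fin by simp
  next
    fix h assume "h \<in> half ` I"
    then obtain i where i: "i \<in> I" "h = half i" by blast
    have "a i \<noteq> 0"
    proof
      assume "a i = 0"
      then have "f i x = 0" for x using a[OF i(1), of x] by simp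
      then show False using tight[OF i(1)] z(2)[OF i(1)] by auto
    qed
    then show "a (g h) \<noteq> 0 \<and> h = {x. a (g h) \<bullet> x \<le> - c (g h)}"
      using i g by (simp add: half_def)
  next
    fix H assume "H \<subset> half ` I"
    then obtain i where i: "i \<in> I" "half i \<notin> H" "H \<subseteq> half ` I" by blast
    obtain v where v: "v \<in> W" "v \<notin> half i" "\<forall>j\<in>I - {i}. v \<in> half j"
      using violate[OF i(1)] by blast
    have "v \<in> affine hull P \<inter> \<Inter>H" using v i hull by blast
    moreover have "v \<notin> P" using v(2) P half[OF i(1)] i(1) by auto
    moreover have "P \<subseteq> affine hull P \<inter> \<Inter>H" using P_eq i(3) by blast
    ultimately show "P \<subset> affine hull P \<inter> \<Inter>H" by blast
  qed
  have face: "P \<inter> {x. a (g (half i)) \<bullet> x = - c (g (half i))} = {x \<in> P. f i x = c i}"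
    if "i \<in> I" for i
    using that a g by auto
  have "{F. F facet_of P} = (\<lambda>i. {x \<in> P. f i x = c i}) ` I"
    using facet face by auto
  moreover have "inj_on (\<lambda>i. {x \<in> P. f i x = c i}) I"
  proof (rule inj_onI, rule ccontr)
    fix i j assume ij: "i \<in> I" "j \<in> I" "{x \<in> P. f i x = c i} = {x \<in> P. f j x = c j}" "i \<noteq> j"
    obtain w where w: "w \<in> W" "f i w = c i" "\<forall>j\<in>I - {i}. c j < f j w"
      using tight[OF ij(1)] by blast
    have "c k \<le> f k w" if "k \<in> I" for k
      using w(2,3) that by (cases "k = i") (auto intro: less_imp_le)
    then have "w \<in> P" unfolding P using w(1) by blast
    then have "f j w = c j" using w(2) ij(3) by blast
    moreover have "c j < f j w" using w(3) ij by blast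
    ultimately show False by simp
  qed
  ultimately show ?thesis by (simp add: bij_betw_def)
qed

section \<open>Points at which exactly one bound is tight\<close>

text \<open>Bounds on the difference of \<open>h\<close> between \<open>(i, j)\<close> and its upper (\<open>V\<close>) or left (\<open>H\<close>)
  neighbour: \<open>lo\<close> bounds it below by 0, \<open>hi\<close> bounds it above by a scale \<open>N\<close>. The
  scale is 1 in the application, and larger values avoid fractions in the witnesses below.\<close>

datatype step_bound = Vlo nat nat | Vhi nat nat | Hlo nat nat | Hhi nat nat

fun slack :: "real \<Rightarrow> (nat \<Rightarrow> nat \<Rightarrow> real) \<Rightarrow> step_bound \<Rightarrow> real" where
  "slack N h (Vlo i j) = h i j - h (i - 1) j"
| "slack N h (Vhi i j) = N - (h i j - h (i - 1) j)"
| "slack N h (Hlo i j) = h i j - h i (j - 1)"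
| "slack N h (Hhi i j) = N - (h i j - h i (j - 1))"

text \<open>Row 1 is special because \<open>h\<close> vanishes on row 0. Its values increase by the
  \<open>Hlo\<close> bounds, so all of them lie between 0 and \<open>N\<close> once the first is at
  least 0 and the last at most \<open>N\<close>; the \<open>Hhi\<close> bounds of row 1 then
  follow.\<close>

fun irredundant :: "nat \<Rightarrow> step_bound \<Rightarrow> bool" where
  "irredundant n (Vlo i j) \<longleftrightarrow> 1 \<le> i \<and> i \<le> j \<and> i + j \<le> n \<and> (i = 1 \<longrightarrow> j = 1)"
| "irredundant n (Vhi i j) \<longleftrightarrow> 1 \<le> i \<and> i \<le> j \<and> i + j \<le> n \<and> (i = 1 \<longrightarrow> j = n - 1)"
| "irredundant n (Hlo i j) \<longleftrightarrow> 1 \<le> i \<and> i < j \<and> i + j \<le> n"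
| "irredundant n (Hhi i j) \<longleftrightarrow> 2 \<le> i \<and> i < j \<and> i + j \<le> n"

definition only_tight :: "nat \<Rightarrow> step_bound \<Rightarrow> real \<Rightarrow> (nat \<Rightarrow> nat \<Rightarrow> real) \<Rightarrow> bool" where
  "only_tight n s N h \<longleftrightarrow> 0 < N \<and> (\<forall>j. h 0 j = 0) \<and> slack N h s = 0 \<and>
     (\<forall>t. irredundant n t \<and> t \<noteq> s \<longrightarrow> 0 < slack N h t)"

lemma only_tightI:
  assumes "0 < N" "\<And>j. h 0 j = 0" "slack N h s = 0"
    and "\<And>i j. irredundant n (Vlo (Suc i) j) \<Longrightarrow> Vlo (Suc i) j \<noteq> s \<Longrightarrow> h i j < h (Suc i) j"
    and "\<And>i j. irredundant n (Vhi (Suc i) j) \<Longrightarrow> Vhi (Suc i) j \<noteq> s \<Longrightarrow> h (Suc i) j < h i j + N"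
    and "\<And>i j. irredundant n (Hlo i (Suc j)) \<Longrightarrow> Hlo i (Suc j) \<noteq> s \<Longrightarrow> h i j < h i (Suc j)"
    and "\<And>i j. irredundant n (Hhi i (Suc j)) \<Longrightarrow> Hhi i (Suc j) \<noteq> s \<Longrightarrow> h i (Suc j) < h i j + N"
  shows "only_tight n s N h"
proof -
  have "0 < slack N h t" if t: "irredundant n t" "t \<noteq> s" for t
  proof (cases t)
    case (Vlo i j)
    then show ?thesis using t assms(4)[of "i - 1" j] by (cases i) auto
  next
    case (Vhi i j)
    then show ?thesis using t assms(5)[of "i - 1" j] by (cases i) auto
  next
    case (Hlo i j)
    then show ?thesis using t assms(6)[of i "j - 1"] by (cases j) auto
  next
    case (Hhi i j)
    then show ?thesis using t assms(7)[of i "j - 1"] by (cases j) auto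
  qed
  then show ?thesis using assms(1-3) by (simp add: only_tight_def)
qed

text \<open>Opposite bumps at two neighbouring points change the step between them by 1 and every
  other step by at most 1/2. So a single step can be closed or filled while steps with margin 1 stay
  strict.\<close>

definition bump :: "nat \<Rightarrow> nat \<Rightarrow> nat \<Rightarrow> nat \<Rightarrow> real" where
  "bump p q a b = (if a = p \<and> b = q then 1/2 else 0)"

lemma bump_bounds: "0 \<le> bump p q a b" "bump p q a b \<le> 1/2"
  by (simp_all add: bump_def)

text \<open>The bound \<open>s\<close> belongs to the step from \<open>(p, q)\<close> to
  \<open>(p', q')\<close>. All steps of \<open>a + b\<close> below row 0 equal 1, and the bumps
  bring this one to 0. The scale is large enough to keep every upper bound strict.\<close>

lemma only_tight_lower:
  assumes s: "s = Vlo (Suc p) q \<and> p' = Suc p \<and> q' = q \<or> s = Hlo p (Suc q) \<and> p' = p \<and> q' = Suc q"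
    and p: "1 \<le> p" "p' + q' \<le> n"
  shows "only_tight n s (4 * real n + 4)
    (\<lambda>a b. if a = 0 then 0 else real a + real b + bump p q a b - bump p' q' a b)"
    (is "only_tight n s ?N ?h")
proof (rule only_tightI)
  show "slack ?N ?h s = 0" using s p by (auto simp: bump_def)
next
  fix i j assume *: "irredundant n (Vlo (Suc i) j)" "Vlo (Suc i) j \<noteq> s"
  then have "bump p q i j + bump p' q' (Suc i) j \<le> 1/2" using s by (auto simp: bump_def)
  then show "?h i j < ?h (Suc i) j"
    using bump_bounds[of p q i j] bump_bounds[of p q "Suc i" j]
      bump_bounds[of p' q' i j] bump_bounds[of p' q' "Suc i" j]
    by (cases "i = 0") (simp_all add: algebra_simps)
next
  fix i j assume "irredundant n (Vhi (Suc i) j)"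
  then have "real i + real j \<le> real n" by simp
  then show "?h (Suc i) j < ?h i j + ?N"
    using bump_bounds[of p q i j] bump_bounds[of p q "Suc i" j]
      bump_bounds[of p' q' i j] bump_bounds[of p' q' "Suc i" j]
    by (cases "i = 0") (simp_all add: algebra_simps)
next
  fix i j assume *: "irredundant n (Hlo i (Suc j))" "Hlo i (Suc j) \<noteq> s"
  then have "bump p q i j + bump p' q' i (Suc j) \<le> 1/2" using s by (auto simp: bump_def)
  then show "?h i j < ?h i (Suc j)"
    using bump_bounds[of p q i j] bump_bounds[of p q i "Suc j"]
      bump_bounds[of p' q' i j] bump_bounds[of p' q' i "Suc j"] *(1)
    by (cases "i = 0") (simp_all add: algebra_simps)
next
  fix i j assume "irredundant n (Hhi i (Suc j))"
  then show "?h i (Suc j) < ?h i j + ?N"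
    using bump_bounds[of p q i j] bump_bounds[of p q i "Suc j"]
      bump_bounds[of p' q' i j] bump_bounds[of p' q' i "Suc j"]
    by (cases "i = 0") (simp_all add: algebra_simps)
qed auto

text \<open>The constant -2 puts the value 0 at \<open>(1, 1)\<close>; all other steps in question
  stay positive.\<close>

lemma only_tight_Vlo_1:
  "only_tight n (Vlo 1 1) (4 * real n + 4) (\<lambda>a b. if a = 0 then 0 else real a + real b - 2)"
  by (rule only_tightI) auto

text \<open>Vertical steps below row 1 are \<open>N - 1\<close>, and the bumps raise one of them to
  \<open>N\<close>. The term \<open>- real n\<close> keeps the value at \<open>(1, n - 1)\<close>
  below \<open>N\<close>.\<close>

lemma only_tight_Vhi:
  assumes p: "1 \<le> p" "Suc p \<le> q" "Suc p + q \<le> n"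
  shows "only_tight n (Vhi (Suc p) q) (4 * real n + 4)
    (\<lambda>a b. if a = 0 then 0 else real a * (4 * real n + 3) + real b - real n +
       bump (Suc p) q a b - bump p q a b)"
    (is "only_tight n ?s ?N ?h")
proof (rule only_tightI)
  show "slack ?N ?h ?s = 0" using p by (simp add: bump_def algebra_simps)
next
  fix i j
  show "?h i j < ?h (Suc i) j"
    using bump_bounds[of "Suc p" q i j] bump_bounds[of "Suc p" q "Suc i" j]
      bump_bounds[of p q i j] bump_bounds[of p q "Suc i" j]
    by (cases "i = 0") (simp_all add: algebra_simps)
next
  fix i j assume *: "irredundant n (Vhi (Suc i) j)" "Vhi (Suc i) j \<noteq> ?s"
  then have "bump (Suc p) q (Suc i) j + bump p q i j \<le> 1/2" by (auto simp: bump_def)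
  moreover have "real j \<le> real n - 1" using * by auto
  ultimately show "?h (Suc i) j < ?h i j + ?N"
    using bump_bounds[of "Suc p" q i j] bump_bounds[of "Suc p" q "Suc i" j]
      bump_bounds[of p q i j] bump_bounds[of p q "Suc i" j]
    by (cases "i = 0") (simp_all add: algebra_simps)
next
  fix i j assume "irredundant n (Hlo i (Suc j))"
  moreover have "bump (Suc p) q i j + bump p q i (Suc j) \<le> 1/2" by (auto simp: bump_def)
  ultimately show "?h i j < ?h i (Suc j)"
    using bump_bounds[of "Suc p" q i j] bump_bounds[of "Suc p" q i "Suc j"]
      bump_bounds[of p q i j] bump_bounds[of p q i "Suc j"]
    by (cases "i = 0") (simp_all add: algebra_simps)
next
  fix i j
  show "?h i (Suc j) < ?h i j + ?N"
    using bump_bounds[of "Suc p" q i j] bump_bounds[of "Suc p" q i "Suc j"]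
      bump_bounds[of p q i j] bump_bounds[of p q i "Suc j"]
    by (cases "i = 0") (simp_all add: algebra_simps)
qed auto

text \<open>The offset \<open>2 - real n\<close> makes the value at \<open>(1, n - 1)\<close>
  exactly \<open>N\<close>.\<close>

lemma only_tight_Vhi_1:
  assumes "2 \<le> n"
  shows "only_tight n (Vhi 1 (n - 1)) (4 * real n + 4)
    (\<lambda>a b. if a = 0 then 0 else real a * (4 * real n + 3) + real b + 2 - real n)"
    (is "only_tight n ?s ?N ?h")
proof (rule only_tightI)
  show "slack ?N ?h ?s = 0" using assms by (auto simp: of_nat_diff)
next
  fix i j assume "irredundant n (Vlo (Suc i) j)" "Vlo (Suc i) j \<noteq> ?s"
  then show "?h i j < ?h (Suc i) j" by (auto simp: algebra_simps)
next
  fix i j assume "irredundant n (Vhi (Suc i) j)" "Vhi (Suc i) j \<noteq> ?s"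
  then show "?h (Suc i) j < ?h i j + ?N" by (auto simp: algebra_simps)
next
  fix i j assume "irredundant n (Hlo i (Suc j))" "Hlo i (Suc j) \<noteq> ?s"
  then show "?h i j < ?h i (Suc j)" by (auto simp: algebra_simps)
next
  fix i j assume "irredundant n (Hhi i (Suc j))" "Hhi i (Suc j) \<noteq> ?s"
  then show "?h i (Suc j) < ?h i j + ?N" by (auto simp: algebra_simps)
qed auto

text \<open>Row \<open>p\<close> has to jump by \<open>N\<close> when it enters column
  \<open>q\<close>. If the rows next to it did not jump, vertical steps would change by
  \<open>N\<close> there and become tight. So all other positive rows jump by about
  \<open>N / 2\<close>, and row \<open>p\<close> starts \<open>N / 4\<close> too low and ends about
  \<open>N / 4\<close> too high; vertical steps next to it then stay roughly between
  \<open>N / 4\<close> and \<open>3 * N / 4\<close>. Row 0 cannot jump, hence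
  \<open>2 \<le> p\<close>.\<close>

lemma only_tight_Hhi:
  assumes p: "2 \<le> p" "p < q" "p + q \<le> n"
  shows "only_tight n (Hhi p q) (8 * real n + 8)
    (\<lambda>a b. if a = 0 then 0 else real b + real a * (4 * real n + 4) -
       (if a = p then 4 * real n + 4 else 2 * real n + 2) +
       (if q \<le> b then if a = p then 8 * real n + 7 else 4 * real n + 4 else 0))"
    (is "only_tight n ?s ?N ?h")
proof (rule only_tightI)
  show "slack ?N ?h ?s = 0" using p by (auto simp: algebra_simps of_nat_diff)
next
  fix i j
  show "?h i j < ?h (Suc i) j"
    using p by (cases "i = 0"; cases "i = p"; cases "Suc i = p"; cases "q \<le> j")
      (auto simp: algebra_simps)
next
  fix i j assume "irredundant n (Vhi (Suc i) j)"
  then have "real j \<le> real n" by simp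
  then show "?h (Suc i) j < ?h i j + ?N"
    using p by (cases "i = 0"; cases "i = p"; cases "Suc i = p"; cases "q \<le> j")
      (auto simp: algebra_simps)
next
  fix i j assume "irredundant n (Hlo i (Suc j))"
  then have "i \<noteq> 0" by simp
  then show "?h i j < ?h i (Suc j)"
    by (cases "i = p"; cases "q \<le> j"; cases "q = Suc j") (simp_all add: algebra_simps)
next
  fix i j assume "irredundant n (Hhi i (Suc j))" "Hhi i (Suc j) \<noteq> ?s"
  then have "i \<noteq> 0" "i = p \<Longrightarrow> q \<noteq> Suc j" by auto
  then show "?h i (Suc j) < ?h i j + ?N"
    by (cases "i = p"; cases "q \<le> j"; cases "q = Suc j") (simp_all add: algebra_simps)
qed auto

lemma ex_only_tight:
  assumes n: "2 \<le> n" and s: "irredundant n s"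
  shows "\<exists>h. only_tight n s 1 h"
proof -
  have "\<exists>N h. only_tight n s N h"
  proof (cases s)
    case (Vlo i j)
    show ?thesis
    proof (cases "i = 1")
      case True
      then show ?thesis using Vlo s only_tight_Vlo_1[of n] by auto
    next
      case False
      then show ?thesis
        using Vlo s only_tight_lower[of s "i - 1" j i j n] by (cases i) auto
    qed
  next
    case (Vhi i j)
    show ?thesis
    proof (cases "i = 1")
      case True
      then show ?thesis using Vhi s only_tight_Vhi_1[OF n] by auto
    next
      case False
      then show ?thesis
        using Vhi s only_tight_Vhi[of "i - 1" j n] by (cases i) auto
    qed
  next
    case (Hlo i j)
    then show ?thesis
      using s only_tight_lower[of s i "j - 1" i j n] by (cases j) auto
  next
    case (Hhi i j)
    then show ?thesis using s only_tight_Hhi[of i j n] by auto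
  qed
  then obtain N h where h: "only_tight n s N h" by blast
  have "slack 1 (\<lambda>i j. h i j / N) t = slack N h t / N" for t
    using h by (cases t) (simp_all add: only_tight_def field_simps)
  then have "only_tight n s 1 (\<lambda>i j. h i j / N)"
    using h by (simp add: only_tight_def)
  then show ?thesis by blast
qed

text \<open>Only the values of \<open>h\<close> at \<open>(i, j)\<close> with \<open>i \<le> j\<close> and \<open>i + j \<le> n\<close> matter; the remaining
  ones are forced by the two reflections.\<close>

definition extend_corner :: "nat \<Rightarrow> (nat \<Rightarrow> nat \<Rightarrow> real) \<Rightarrow> nat \<Rightarrow> nat \<Rightarrow> real" where
  "extend_corner n h i j =
     (if i + j \<le> n then h (min i j) (max i j)
      else h (n - max i j) (n - min i j) + (real i + real j - real n))"

lemma corner_function_extend_corner: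
  assumes h: "\<And>j. h 0 j = 0"
  shows "corner_function n 1 (extend_corner n h)"
  unfolding corner_function_def
proof (intro conjI allI impI)
  fix i j assume ij: "i \<le> n" "j \<le> n"
  show "extend_corner n h i j = extend_corner n h j i"
    by (simp add: extend_corner_def add.commute min.commute max.commute)
  have m: "min (n - j) (n - i) = n - max i j" "max (n - j) (n - i) = n - min i j"
    "n - (n - min i j) = min i j" "n - (n - max i j) = max i j"
    using ij by (auto simp: min_def max_def)
  consider "i + j < n" | "i + j = n" | "i + j > n" by linarith
  then show "extend_corner n h (n - j) (n - i) =
      extend_corner n h i j + 1 * (real n - real i - real j)"
  proof cases
    case 1
    then have "\<not> n - j + (n - i) \<le> n" by auto
    then show ?thesis using 1 ij unfolding extend_corner_def m by (simp add: of_nat_diff)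
  next
    case 2
    then have "n - j = i" "n - i = j" by auto
    then show ?thesis using 2 by simp
  next
    case 3
    then have "n - j + (n - i) \<le> n" by auto
    then show ?thesis using 3 ij unfolding extend_corner_def m by (simp add: of_nat_diff)
  qed
qed (simp add: extend_corner_def h)

section \<open>The facets\<close>

text \<open>Both kinds of inequality, \<open>0 \<le> L\<close> and \<open>L \<le> 1\<close>, take the form
  \<open>- eq_rhs e \<le> signed_lhs n pos e Y\<close>.\<close>

fun signed_lhs :: "nat \<Rightarrow> ('c::finite \<Rightarrow> nat \<times> nat) \<Rightarrow> equation \<Rightarrow> real ^ 'c \<Rightarrow> real" where
  "signed_lhs n pos (L_eq i j c) = (\<lambda>Y. (1 - 2 * c) * L_sum n pos i j Y)"
| "signed_lhs n pos (M_eq j c) = (\<lambda>Y. (1 - 2 * c) * M_sum n pos j Y)"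

fun eq_rhs :: "equation \<Rightarrow> real" where
  "eq_rhs (L_eq i j c) = c"
| "eq_rhs (M_eq j c) = c"

text \<open>For \<open>j < i\<close> transposition turns the vertical step at \<open>(i, j)\<close>
  into a horizontal one. For \<open>j > n - i\<close> the value of \<open>L\<close> is 1 minus a
  horizontal step, so the upper and lower bounds change places. With \<open>k = n div 2\<close>,
  these cases reach columns up to \<open>k\<close> and from \<open>n + 1 - k\<close> on; for odd
  \<open>n\<close> column \<open>k + 1\<close> lies between them and belongs to
  \<open>M_eq\<close>.\<close>

fun step_bound_of :: "nat \<Rightarrow> equation \<Rightarrow> step_bound" where
  "step_bound_of n (L_eq i j c) =
     (if j < i then if c = 0 then Hlo j i else Hhi j i
      else if j \<le> n - i then if c = 0 then Vlo i j else Vhi i j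
      else if c = 0 then Hhi (n - j) (n + 1 - i) else Hlo (n - j) (n + 1 - i))"
| "step_bound_of n (M_eq j c) = (if c = 0 then Hlo j (n div 2 + 1) else Hhi j (n div 2 + 1))"

lemma linear_signed_lhs: "linear (signed_lhs n pos e)"
  by (cases e) (auto intro!: linear_compose_scale_right linear_L_sum linear_M_sum
      simp flip: real_scaleR_def)

section \<open>Listed equations and difference bounds\<close>

lemma L_eq_mem_iff:
  "L_eq i j c \<in> facet_equations n \<longleftrightarrow>
     c = 0 \<and> (i = 1 \<and> j = 1 \<or> i \<in> {2..n div 2} \<and> j \<in> {1..n - 2}) \<or>
     c = 1 \<and> (i = 1 \<and> j = n - 1 \<or> i \<in> {2..n div 2} \<and> j \<in> {2..n - 1})"
  by (auto simp: facet_equations_def Let_def)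

lemma M_eq_mem_iff:
  "M_eq j c \<in> facet_equations n \<longleftrightarrow>
     odd n \<and> (c = 0 \<and> j \<in> {1..n div 2} \<or> c = 1 \<and> j \<in> {2..n div 2})"
  by (auto simp: facet_equations_def Let_def)

lemma L_eq_mem_bounds:
  assumes "L_eq i j c \<in> facet_equations n" "2 \<le> n"
  shows "1 \<le> i" "2 * i \<le> n" "1 \<le> j" "j \<le> n - 1" "c = 0 \<or> c = 1"
    "c = 0 \<Longrightarrow> i = 1 \<and> j = 1 \<or> 2 \<le> i \<and> j \<le> n - 2"
    "c = 1 \<Longrightarrow> i = 1 \<and> j = n - 1 \<or> 2 \<le> i \<and> 2 \<le> j"
  using assms unfolding L_eq_mem_iff by auto

lemma M_eq_mem_bounds:
  assumes "M_eq j c \<in> facet_equations n"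
  shows "odd n" "1 \<le> j" "j \<le> n div 2" "c = 0 \<or> c = 1" "c = 1 \<Longrightarrow> 2 \<le> j"
  using assms unfolding M_eq_mem_iff by auto

lemma irredundant_step_bound_of:
  assumes e: "e \<in> facet_equations n" and n: "2 \<le> n"
  shows "irredundant n (step_bound_of n e)"
proof (cases e)
  case (L_eq i j c)
  then show ?thesis using L_eq_mem_bounds[OF e[unfolded L_eq] n] n by auto
next
  case (M_eq j c)
  then show ?thesis using M_eq_mem_bounds[OF e[unfolded M_eq]] by (auto elim!: oddE)
qed

lemma inj_on_step_bound_of:
  assumes n: "2 \<le> n"
  shows "inj_on (step_bound_of n) (facet_equations n)"
proof (rule inj_onI)
  fix e f assume e: "e \<in> facet_equations n" and f: "f \<in> facet_equations n"
    and eq: "step_bound_of n e = step_bound_of n f"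
  have LM: False if "L_eq i j c \<in> facet_equations n" "M_eq j' c' \<in> facet_equations n"
    "step_bound_of n (L_eq i j c) = step_bound_of n (M_eq j' c')" for i j c j' c'
    using L_eq_mem_bounds[OF that(1) n] M_eq_mem_bounds[OF that(2)] that(3)
    by (auto split: if_splits elim!: oddE)
  show "e = f"
  proof (cases e)
    case e_L: (L_eq i j c)
    show ?thesis
    proof (cases f)
      case f_L: (L_eq i' j' c')
      then show ?thesis
        using L_eq_mem_bounds(1-5)[OF e[unfolded e_L] n] L_eq_mem_bounds(1-5)[OF f[unfolded f_L] n]
          eq e_L by (auto split: if_splits)
    next
      case (M_eq j' c')
      then show ?thesis using LM e f eq e_L by metis
    qed
  next
    case e_M: (M_eq j c)
    show ?thesis
    proof (cases f)
      case (L_eq i' j' c')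
      then show ?thesis using LM e f eq e_M by metis
    next
      case f_M: (M_eq j' c')
      then show ?thesis
        using M_eq_mem_bounds(4)[OF e[unfolded e_M]] M_eq_mem_bounds(4)[OF f[unfolded f_M]]
          eq e_M by (auto split: if_splits)
    qed
  qed
qed

text \<open>With \<open>k = n div 2\<close>, the equations for \<open>L\<close> number
  \<open>2 * (k - 1) * (n - 2) + 2\<close>. This is the claim for \<open>n = 2 * k\<close>; for
  \<open>n = 2 * k + 1\<close> the \<open>2 * k - 1 = n - 2\<close> equations for \<open>M\<close>
  complete the square.\<close>

lemma card_facet_equations:
  assumes n: "2 \<le> n"
  shows "finite (facet_equations n)" "card (facet_equations n) = (n - 2)\<^sup>2 + 2"
proof -
  let ?k = "n div 2"
  define L0 where "L0 = (\<lambda>(i, j). L_eq i j 0) ` ({(1, 1)} \<union> {2..?k} \<times> {1..n - 2})"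
  define L1 where "L1 = (\<lambda>(i, j). L_eq i j 1) ` ({(1, n - 1)} \<union> {2..?k} \<times> {2..n - 1})"
  define M0 where "M0 = (\<lambda>j. M_eq j 0) ` {1..?k}"
  define M1 where "M1 = (\<lambda>j. M_eq j 1) ` {2..?k}"
  have image: "{L_eq i j c | i j. (i, j) \<in> A} = (\<lambda>(i, j). L_eq i j c) ` A"
    "{M_eq j c | j. j \<in> B} = (\<lambda>j. M_eq j c) ` B" for A B c
    by auto
  have eq: "facet_equations n = (L0 \<union> L1) \<union> (if odd n then M0 \<union> M1 else {})"
    unfolding facet_equations_def Let_def image L0_def L1_def M0_def M1_def by (rule refl)
  have fin: "finite L0" "finite L1" "finite M0" "finite M1"
    by (simp_all add: L0_def L1_def M0_def M1_def)
  have L0: "card L0 = 1 + (?k - 1) * (n - 2)"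
    unfolding L0_def by (subst card_image) (auto simp: inj_on_def card_cartesian_product)
  have L1: "card L1 = 1 + (?k - 1) * (n - 2)"
    unfolding L1_def by (subst card_image) (auto simp: inj_on_def card_cartesian_product)
  have M0: "card M0 = ?k" and M1: "card M1 = ?k - 1"
    unfolding M0_def M1_def by (subst card_image; auto simp: inj_on_def)+
  have "L0 \<inter> L1 = {}" "M0 \<inter> M1 = {}" by (auto simp: L0_def L1_def M0_def M1_def)
  then have L: "card (L0 \<union> L1) = 2 + 2 * ((?k - 1) * (n - 2))" and M: "card (M0 \<union> M1) = ?k + (?k - 1)"
    using fin L0 L1 M0 M1 by (simp_all add: card_Un_disjoint)
  have LM: "(L0 \<union> L1) \<inter> (M0 \<union> M1) = {}" by (auto simp: L0_def L1_def M0_def M1_def)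
  show "finite (facet_equations n)" using fin by (simp add: eq)
  show "card (facet_equations n) = (n - 2)\<^sup>2 + 2"
  proof (cases "odd n")
    case True
    then obtain m where m: "n = 2 * m + 1" by (auto elim: oddE)
    then obtain m' where m': "m = Suc m'" using n by (cases m) auto
    have "card (facet_equations n) = card (L0 \<union> L1) + card (M0 \<union> M1)"
      using True LM fin by (simp add: eq card_Un_disjoint)
    also have "\<dots> = (n - 2)\<^sup>2 + 2"
      unfolding L M by (simp add: m m' power2_eq_square algebra_simps)
    finally show ?thesis .
  next
    case False
    then obtain m where m: "n = 2 * m" by auto
    then obtain m' where m': "m = Suc m'" using n by (cases m) auto
    have "card (facet_equations n) = card (L0 \<union> L1)" using False by (simp add: eq)
    also have "\<dots> = (n - 2)\<^sup>2 + 2"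
      unfolding L by (simp add: m m' power2_eq_square algebra_simps)
    finally show ?thesis .
  qed
qed

context
  fixes n :: nat and pos :: "'c::finite \<Rightarrow> nat \<times> nat"
  assumes n: "2 \<le> n" and pos: "bij_betw pos UNIV (core_positions n)"
begin

lemma signed_lhs_core_extend:
  assumes e: "e \<in> facet_equations n" and h: "\<And>j. h 0 j = 0"
  shows "signed_lhs n pos e (core pos (diff2 (extend_corner n h))) =
    slack 1 h (step_bound_of n e) - eq_rhs e"
proof -
  let ?E = "extend_corner n h" and ?k = "n div 2"
  note E = corner_function_extend_corner[of h n, OF h]
  show ?thesis
  proof (cases e)
    case (L_eq i j c)
    note b = L_eq_mem_bounds[OF e[unfolded L_eq] n]
    have i: "i \<in> {1..?k}" "i \<le> n" and j: "j \<le> n" using b by auto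
    have L: "L_sum n pos i j (core pos (diff2 ?E)) = ?E i j - ?E (i - 1) j"
      using L_sum_core[OF pos bisymmetric_diff2[OF E] i(1) j] row_sum_diff2[OF E b(1) i(2) j] by simp
    consider "j < i" | "i \<le> j" "j \<le> n - i" | "n - i < j" by linarith
    then show ?thesis
    proof cases
      case 1
      then have "i + j \<le> n" "i - 1 + j \<le> n" "min i j = j" "max i j = i"
        "min (i - 1) j = j" "max (i - 1) j = i - 1"
        using b by (auto simp: min_def max_def)
      then have "?E i j - ?E (i - 1) j = h j i - h j (i - 1)"
        by (simp only: extend_corner_def if_True)
      then show ?thesis using 1 b(5) L L_eq by auto
    next
      case 2
      then have "i + j \<le> n" "i - 1 + j \<le> n" "min i j = i" "max i j = j"
        "min (i - 1) j = i - 1" "max (i - 1) j = j"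
        using b by (auto simp: min_def max_def)
      then have "?E i j - ?E (i - 1) j = h i j - h (i - 1) j"
        by (simp only: extend_corner_def if_True)
      then show ?thesis using 2 b(5) L L_eq by auto
    next
      case 3
      then have ij: "\<not> i + j \<le> n" "i \<le> j" "\<not> j < i" "\<not> j \<le> n - i" using b by auto
      have "?E i j = h (n - j) (n - i) + (real i + real j - real n)"
        using ij by (simp add: extend_corner_def min_def max_def)
      moreover have "?E (i - 1) j = h (n - j) (n + 1 - i) + (real i - 1 + real j - real n)"
      \<comment> \<open>For \<open>j = n + 1 - i\<close> the upper neighbour lies on the
        antidiagonal, where \<open>extend_corner\<close> takes its other branch; both formulas agree
        there because the correction term is 0.\<close>
      proof (cases "i - 1 + j \<le> n")
        case True
        then have "min (i - 1) j = n - j" "max (i - 1) j = n + 1 - i" "real i + real j = real n + 1"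
          using ij b by (auto simp: min_def max_def)
        moreover from this True have "?E (i - 1) j = h (n - j) (n + 1 - i)"
          by (simp only: extend_corner_def if_True)
        ultimately show ?thesis by simp
      next
        case False
        moreover have "min (i - 1) j = i - 1" "max (i - 1) j = j" "n - (i - 1) = n + 1 - i"
          "real (i - 1) = real i - 1" using b ij by (auto simp: min_def max_def)
        ultimately show ?thesis by (simp only: extend_corner_def if_False)
      qed
      ultimately show ?thesis using ij b(5) L L_eq by auto
    qed
  next
    case (M_eq j c)
    note b = M_eq_mem_bounds[OF e[unfolded M_eq]]
    have n2: "n = 2 * ?k + 1" using b(1) by presburger
    have i: "1 \<le> ?k + 1" "?k + 1 \<le> n" "j \<le> n" using b n n2 by auto
    have "M_sum n pos j (core pos (diff2 ?E)) = ?E (?k + 1) j - ?E ?k j"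
      using M_sum_core[OF pos bisymmetric_diff2[OF E] b(1,3)] row_sum_diff2[OF E i] by simp
    also have "?E (?k + 1) j - ?E ?k j = h j (?k + 1) - h j ?k"
    proof -
      have "?k + 1 + j \<le> n" "?k + j \<le> n" using b n2 by linarith+
      then show ?thesis using b by (simp add: extend_corner_def min_def max_def)
    qed
    finally show ?thesis using b(4) M_eq by auto
  qed
qed

text \<open>The unlisted bounds are recovered through row 1. Its inner entries are nonnegative by
  listed bounds, so its partial sums increase from \<open>L\<close> at \<open>(1, 1)\<close> to
  \<open>L\<close> at \<open>(1, n - 1)\<close> and lie in \<open>{0..1}\<close>. Hence its inner
  entries are at most 1, which gives the upper bounds for \<open>j = 1\<close> and the lower bounds
  for \<open>j = n - 1\<close>.\<close>

lemma core_polytope_eq_facet_constraints: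
  "core_polytope n pos =
     {Y \<in> core_hull n pos. \<forall>e\<in>facet_equations n. - eq_rhs e \<le> signed_lhs n pos e Y}"
proof (intro set_eqI iffI)
  fix Y assume Y: "Y \<in> core_polytope n pos"
  have "- eq_rhs e \<le> signed_lhs n pos e Y" if e: "e \<in> facet_equations n" for e
  proof (cases e)
    case (L_eq i j c)
    note b = L_eq_mem_bounds[OF e[unfolded L_eq] n]
    have "i \<in> {1..n div 2}" "j \<in> {1..n - 1}" using b by auto
    then have "L_sum n pos i j Y \<in> {0..1}" using Y by (auto simp: core_polytope_def)
    then show ?thesis using b(5) L_eq by auto
  next
    case (M_eq j c)
    note b = M_eq_mem_bounds[OF e[unfolded M_eq]]
    have "M_sum n pos j Y \<in> {0..1}" using Y b by (auto simp: core_polytope_def)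
    then show ?thesis using b(4) M_eq by auto
  qed
  then show "Y \<in> {Y \<in> core_hull n pos. \<forall>e\<in>facet_equations n. - eq_rhs e \<le> signed_lhs n pos e Y}"
    using Y by (simp add: core_polytope_def)
next
  fix Y assume Y: "Y \<in> {Y \<in> core_hull n pos. \<forall>e\<in>facet_equations n. - eq_rhs e \<le> signed_lhs n pos e Y}"
  let ?k = "n div 2"
  define X where "X = full_matrix n pos Y"
  have Yh: "Y \<in> core_hull n pos" using Y by simp
  have listed: "- eq_rhs e \<le> signed_lhs n pos e Y" if "e \<in> facet_equations n" for e
    using Y that by simp
  have L_ge: "0 \<le> L_sum n pos i j Y" if "L_eq i j 0 \<in> facet_equations n" for i j
    using listed[OF that] by simp
  have L_le: "L_sum n pos i j Y \<le> 1" if "L_eq i j 1 \<in> facet_equations n" for i j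
    using listed[OF that] by simp
  have M_ge: "0 \<le> M_sum n pos j Y" if "M_eq j 0 \<in> facet_equations n" for j
    using listed[OF that] by simp
  have M_le: "M_sum n pos j Y \<le> 1" if "M_eq j 1 \<in> facet_equations n" for j
    using listed[OF that] by simp
  have bi: "bisymmetric n X" unfolding X_def by (rule bisymmetric_full_matrix)
  have row_1: "row_sum X j 1 = X 1 j" if "1 \<le> j" "j \<le> n" for j
    using bisymmetricD(1)[OF bi that, of 1] that by (simp add: row_sum_def)
  have row_last: "row_sum X j (n - 1) = 1 - X 1 (n + 1 - j)" if "1 \<le> j" "j \<le> n" for j
  proof -
    have "X j n = X 1 (n + 1 - j)" using bisymmetricD(2)[OF bi that, of n] n by simp
    then show ?thesis
      using row_sum_diff[of n X j] full_matrix_total[OF pos Yh that] n by (simp add: X_def)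
  qed
  have L: "L_sum n pos i j Y = row_sum X i j" if "i \<in> {1..?k}" "j \<le> n" for i j
    unfolding X_def by (rule L_sum_eq_row_sum[OF pos that])
  have M_1: "M_sum n pos 1 Y = X 1 (?k + 1)" if "odd n"
    using M_sum_eq_row_sum[OF pos that, of 1 Y] row_1[of "?k + 1"] n by (simp add: X_def)
  have k: "1 \<in> {1..?k}" using n by auto
  \<comment> \<open>By symmetry an inner entry of row 1 is the first entry of another row, that is
    \<open>L\<close> or \<open>M\<close> at 1; for a lower row it is the last entry of the mirrored
    upper row, that is \<open>1 - L\<close> at \<open>n - 1\<close>.\<close>
  have X_ge: "0 \<le> X 1 j" if j: "2 \<le> j" "j \<le> n - 1" for j
  proof -
    have j': "1 \<le> j" "j \<le> n" using j by auto
    then show ?thesis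
    proof (cases j rule: row_cases[OF pos, consumes 2, case_names upper middle lower])
      case upper
      have "0 \<le> L_sum n pos j 1 Y"
        using upper j by (intro L_ge) (auto simp: L_eq_mem_iff)
      then show ?thesis using L[OF upper, of 1] row_1[OF j'] n by simp
    next
      case middle
      have "0 \<le> M_sum n pos 1 Y"
        using middle j by (intro M_ge) (auto simp: M_eq_mem_iff)
      then show ?thesis using M_1 middle by simp
    next
      case lower
      have "L_sum n pos (n + 1 - j) (n - 1) Y \<le> 1"
        using lower j by (intro L_le) (auto simp: L_eq_mem_iff)
      moreover have "n + 1 - (n + 1 - j) = j" using j' by simp
      ultimately show ?thesis using L[OF lower, of "n - 1"] row_last[of "n + 1 - j"] j' by simp
    qed
  qed
  have row1: "row_sum X 1 j \<in> {0..1}" if j: "1 \<le> j" "j \<le> n - 1" for j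
  proof -
    have "row_sum X 1 1 \<le> row_sum X 1 j" "row_sum X 1 j \<le> row_sum X 1 (n - 1)"
      unfolding row_sum_def by (rule sum_mono2; use j X_ge in force)+
    moreover have "0 \<le> row_sum X 1 1"
      using L_ge[of 1 1] L[OF k, of 1] n by (simp add: L_eq_mem_iff)
    moreover have "row_sum X 1 (n - 1) \<le> 1"
      using L_le[of 1 "n - 1"] L[OF k, of "n - 1"] n by (simp add: L_eq_mem_iff)
    ultimately show ?thesis by auto
  qed
  have X_le: "X 1 j \<le> 1" if j: "2 \<le> j" "j \<le> n - 1" for j
  proof -
    have "1 \<le> j" "1 \<le> j - 1" "j - 1 \<le> n - 1" using j by auto
    then show ?thesis
      using row_sum_diff[of j X 1] row1[OF _ j(2)] row1[of "j - 1"] by simp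
  qed
  have "L_sum n pos i j Y \<in> {0..1}" if i: "i \<in> {1..?k}" and j: "j \<in> {1..n - 1}" for i j
  proof (cases "i = 1")
    case True
    then show ?thesis using L[OF i, of j] row1[of j] j by auto
  next
    case False
    have i': "1 \<le> i" "i \<le> n" "2 \<le> i" "i \<le> n - 1" using i False by auto
    have "0 \<le> L_sum n pos i j Y"
    proof (cases "j = n - 1")
      case True
      have "X 1 (n + 1 - i) \<le> 1" using i' by (intro X_le) auto
      then show ?thesis using L[OF i, of j] row_last[OF i'(1,2)] True by simp
    next
      case False
      then show ?thesis using i i' j by (intro L_ge) (auto simp: L_eq_mem_iff)
    qed
    moreover have "L_sum n pos i j Y \<le> 1"
    proof (cases "j = 1")
      case True
      then show ?thesis using L[OF i, of j] row_1[OF i'(1,2)] X_le[OF i'(3,4)] n by simp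
    next
      case False
      then show ?thesis using i i' j by (intro L_le) (auto simp: L_eq_mem_iff)
    qed
    ultimately show ?thesis by simp
  qed
  moreover have "M_sum n pos j Y \<in> {0..1}" if "odd n" and j: "j \<in> {1..?k}" for j
  proof -
    have "0 \<le> M_sum n pos j Y" using that by (intro M_ge) (auto simp: M_eq_mem_iff)
    moreover have "M_sum n pos j Y \<le> 1"
    proof (cases "j = 1")
      case True
      have "n = 2 * ?k + 1" using that(1) by presburger
      then have "X 1 (?k + 1) \<le> 1" using n by (intro X_le) auto
      then show ?thesis using M_1 that(1) True by simp
    next
      case False
      then show ?thesis using that by (intro M_le) (auto simp: M_eq_mem_iff)
    qed
    ultimately show ?thesis by simp
  qed
  ultimately show "Y \<in> core_polytope n pos" using Yh by (simp add: core_polytope_def)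
qed

lemma bij_betw_eq_face: "bij_betw (eq_face n pos) (facet_equations n) {F. F facet_of P_core n pos}"
proof -
  let ?P = "P_core n pos"
  have P: "?P = {Y \<in> core_hull n pos. \<forall>e\<in>facet_equations n. - eq_rhs e \<le> signed_lhs n pos e Y}"
    using P_core_eq_core_polytope[OF pos] core_polytope_eq_facet_constraints by simp
  \<comment> \<open>All partial sums of rows are \<open>j / n\<close>, strictly between 0 and 1 for
    \<open>1 \<le> j \<le> n - 1\<close>, so this is a strict point.\<close>
  define U where "U = core pos (\<lambda>_ _. 1 / real n)"
  have U_bi: "bisymmetric n (\<lambda>_ _. 1 / real n)" by (simp add: bisymmetric_def)
  have U_row: "row_sum (\<lambda>_ _. 1 / real n) i j = real j / real n" for i j
    by (simp add: row_sum_def)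
  have U_hull: "U \<in> core_hull n pos"
    unfolding U_def by (rule core_mem_core_hull[OF pos U_bi]) (use n in \<open>simp add: U_row\<close>)
  have U_strict: "- eq_rhs e < signed_lhs n pos e U" if e: "e \<in> facet_equations n" for e
  proof (cases e)
    case (L_eq i j c)
    note b = L_eq_mem_bounds[OF e[unfolded L_eq] n]
    have "i \<in> {1..n div 2}" "j \<le> n" using b by auto
    then have "L_sum n pos i j U = real j / real n"
      unfolding U_def using L_sum_core[OF pos U_bi] by (simp add: U_row)
    moreover have "0 < real j / real n" "real j / real n < 1" using b n by auto
    ultimately show ?thesis using b(5) L_eq by auto
  next
    case (M_eq j c)
    note b = M_eq_mem_bounds[OF e[unfolded M_eq]]
    have "M_sum n pos j U = real j / real n"
      unfolding U_def using M_sum_core[OF pos U_bi b(1,3)] by (simp add: U_row)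
    moreover have "0 < real j / real n" "real j / real n < 1" using b n by auto
    ultimately show ?thesis using b(4) M_eq by auto
  qed
  have tight: "\<exists>W\<in>core_hull n pos. signed_lhs n pos e W = - eq_rhs e \<and>
      (\<forall>f\<in>facet_equations n - {e}. - eq_rhs f < signed_lhs n pos f W)"
    if e: "e \<in> facet_equations n" for e
  proof -
    obtain h where h: "only_tight n (step_bound_of n e) 1 h"
      using ex_only_tight[OF n irredundant_step_bound_of[OF e n]] by blast
    then have h0: "\<And>j. h 0 j = 0" by (simp add: only_tight_def)
    note E = corner_function_extend_corner[of h n, OF h0]
    let ?W = "core pos (diff2 (extend_corner n h))"
    have "?W \<in> core_hull n pos"
    proof (rule core_mem_core_hull[OF pos bisymmetric_diff2[OF E]])
      fix i assume "i \<in> {1..n div 2}"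
      then have i: "1 \<le> i" "i \<le> n" "i - 1 \<le> n" by auto
      show "row_sum (diff2 (extend_corner n h)) i n = 1"
        using row_sum_diff2[OF E i(1,2) order.refl] corner_functionD(5)[OF E i(2) order.refl]
          corner_functionD(5)[OF E i(3) order.refl] i(1) by (simp add: of_nat_diff)
    qed
    moreover have "signed_lhs n pos e ?W = - eq_rhs e"
      using signed_lhs_core_extend[of e h, OF e h0] h by (simp add: only_tight_def)
    moreover have "- eq_rhs f < signed_lhs n pos f ?W" if f: "f \<in> facet_equations n - {e}" for f
    proof -
      have "step_bound_of n f \<noteq> step_bound_of n e"
        using inj_on_step_bound_of[OF n] e f by (auto dest: inj_onD)
      then have "0 < slack 1 h (step_bound_of n f)"
        using h irredundant_step_bound_of[OF _ n, of f] f by (simp add: only_tight_def)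
      then show ?thesis using signed_lhs_core_extend[of f h, OF _ h0] f by simp
    qed
    ultimately show ?thesis by blast
  qed
  have "bij_betw (\<lambda>e. {Y \<in> ?P. signed_lhs n pos e Y = - eq_rhs e}) (facet_equations n)
      {F. F facet_of ?P}"
    by (rule facets_bij_betw_constraints[OF card_facet_equations(1)[OF n] affine_core_hull
          linear_signed_lhs P U_hull U_strict tight])
  \<comment> \<open>For \<open>c\<close> equal to 0 or 1 the factor \<open>1 - 2 * c\<close> is 1 or
    -1, and the signed equation is equivalent to the listed one.\<close>
  moreover have "eq_face n pos e = {Y \<in> ?P. signed_lhs n pos e Y = - eq_rhs e}"
    if e: "e \<in> facet_equations n" for e
  proof (cases e)
    case (L_eq i j c)
    then show ?thesis using L_eq_mem_bounds(5)[OF e[unfolded L_eq] n] by auto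
  next
    case (M_eq j c)
    then show ?thesis using M_eq_mem_bounds(4)[OF e[unfolded M_eq]] by auto
  qed
  ultimately show ?thesis by (subst bij_betw_cong) auto
qed

end

theorem theorem8p5:
  fixes n :: nat and pos :: "'c::finite \<Rightarrow> nat \<times> nat"
  assumes "n \<ge> 2"
    and "bij_betw pos UNIV (core_positions n)"
  shows "bij_betw (eq_face n pos) (facet_equations n) {F. F facet_of P_core n pos} \<and>
         card {F. F facet_of P_core n pos} = (n - 2)\<^sup>2 + 2"
  using bij_betw_eq_face[OF assms] card_facet_equations(2)[OF assms(1)] bij_betw_same_card
  by metis

end
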